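(* Let $P$ be a point not on the extended sides of triangle $ABC$ or of $K^{-1}(ABC)$, and assume that $H=A$, $O=D_0$, and $D_3$ is the midpoint of $AP'$. Then the circumconic $\tilde{\mathcal{C}}_O$ equals $\iota(l)$, where $l=K^{-1}(AQ)=K^{-2}(BC)$ is the line through the reflection $\tilde A$ of $A$ in $O$ parallel to the side $BC$. The points $O,O',P,P'$ are collinear, with $d(O,P')=3\,d(O,P)$, and the map $\mathsf{M}$ taking $\tilde{\mathcal{C}}_O$ to the inconic $\mathcal{I}$ is a translation. In this situation, the point $P$ is one of the two points in the intersection $l_G\cap\tilde{\mathcal{C}}_O$, where $l_G$ is the line through the centroid $G$ which is parallel to $BC$.
   Context: Work in the extended Euclidean plane (the Euclidean plane together with the line at infinity $l_\infty$). $ABC$ is an ordinary triangle with centroid $G$; $D_0,E_0,F_0$ are the midpoints of $BC,CA,AB$. $K$ (complement map) is the homothety with center $G$ and ratio $-1/2$; $K^{-1}(ABC)$ is the anticomplementary triangle. The isotomic map $\iota$ is $(x,y,z)\mapsto(1/x,1/y,1/z)$ in homogeneous barycentric coordinates; for a line $l: px+qy+rz=0$, $\iota(l)$ denotes the circumconic $pyz+qzx+rxy=0$. For a point $P$ not on the extended sides of $ABC$ or $K^{-1}(ABC)$: $P'=\iota(P)$, $Q=K(P')$, $Q'=K(P)$; $D,E,F$ are the traces of $P$ on $BC,CA,AB$ (i.e. $D=AP\cap BC$, etc.); $D_3,E_3,F_3$ are the traces of $P'$ on $BC,CA,AB$. $T_P$ and $T_{P'}$ are the unique affine maps taking $A,B,C$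 to $D,E,F$ and to $D_3,E_3,F_3$, respectively. The generalized orthocenter $H$ of $P$ is the unique point such that $HA,HB,HC$ are parallel to $QD,QE,QF$, respectively (the condition at a vertex being void if $H$ is that vertex); equivalently $H=K^{-1}\circ T_{P'}^{-1}\circ K(Q)$. The generalized circumcenter of $P$ is $O=K(H)=T_{P'}^{-1}\circ K(Q)$, and $O'=T_P^{-1}\circ K(Q')$ is the generalized circumcenter of $P'$. $\mathcal{N}_{P'}$ is the nine-point conic of the quadrangle $ABCP'$ (the conic through the midpoints of its six sides and its three diagonal points), and $\tilde{\mathcal{C}}_O=T_{P'}^{-1}(\mathcal{N}_{P'})$, a circumconic of $ABC$ with center $O$. $\mathcal{I}$ is the conic with center $Q$ tangent to the sides of $ABC$ at $D,E,F$. $\mathsf{M}=T_P\circ K^{-1}\circ T_{P'}$; it is known to be a homothety or translation mapping $\tilde{\mathcal{C}}_O$ to $\mathcal{I}$. $d(X,Y)$ is Euclidean distance. *)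

theory Defs
  imports "HOL-Analysis.Analysis"
begin

section \<open>The extended Euclidean plane\<close>

text \<open>
  A point of the extended plane is a nonzero vector of \<open>real^2 \<times> real\<close> up to a nonzero scalar:
  \<open>(x, 1)\<close> represents the ordinary point \<open>x\<close>, and \<open>(v, 0)\<close> the point at infinity in
  direction \<open>v\<close>.
\<close>

definition proj_rel :: "(real^2) \<times> real \<Rightarrow> (real^2) \<times> real \<Rightarrow> bool" where
  "proj_rel v w \<longleftrightarrow> v \<noteq> 0 \<and> w \<noteq> 0 \<and> (\<exists>k. k \<noteq> 0 \<and> w = k *\<^sub>R v)"

lemma part_equivp_proj_rel: "part_equivp proj_rel"
proof (rule part_equivpI)
  have "proj_rel (0, 1) (0, 1)"
    unfolding proj_rel_def by (auto simp: zero_prod_def intro!: exI[of _ 1])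
  then show "\<exists>x. proj_rel x x" by blast
next
  show "symp proj_rel"
  proof (rule sympI)
    fix v w assume "proj_rel v w"
    then obtain k where "v \<noteq> 0" "w \<noteq> 0" "k \<noteq> 0" "w = k *\<^sub>R v"
      unfolding proj_rel_def by blast
    then show "proj_rel w v"
      unfolding proj_rel_def by (auto intro!: exI[of _ "inverse k"])
  qed
next
  show "transp proj_rel"
  proof (rule transpI)
    fix u v w assume "proj_rel u v" "proj_rel v w"
    then obtain k l where "u \<noteq> 0" "w \<noteq> 0" "k \<noteq> 0" "v = k *\<^sub>R u" "l \<noteq> 0" "w = l *\<^sub>R v"
      unfolding proj_rel_def by blast
    then show "proj_rel u w"
      unfolding proj_rel_def by (auto intro!: exI[of _ "l * k"])
  qed
qed

quotient_type epoint = "(real^2) \<times> real" / partial: proj_rel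
  by (rule part_equivp_proj_rel)

definition hom :: "real^2 \<Rightarrow> (real^2) \<times> real" where
  "hom x = (x, 1)"

definition ord_pt :: "real^2 \<Rightarrow> epoint" where
  "ord_pt x = abs_epoint (hom x)"

definition is_line :: "epoint set \<Rightarrow> bool" where
  "is_line L \<longleftrightarrow> (\<exists>u. u \<noteq> 0 \<and> L = {X. inner u (rep_epoint X) = 0})"

definition line_at_infinity :: "epoint set" where
  "line_at_infinity = {X. snd (rep_epoint X) = 0}"

definition ecollinear :: "epoint set \<Rightarrow> bool" where
  "ecollinear S \<longleftrightarrow> (\<exists>L. is_line L \<and> S \<subseteq> L)"

text \<open>The following two are meant for distinct points and distinct lines, respectively.\<close>

definition join :: "epoint \<Rightarrow> epoint \<Rightarrow> epoint set" where
  "join X Y = (THE L. is_line L \<and> X \<in> L \<and> Y \<in> L)"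

definition meet :: "epoint set \<Rightarrow> epoint set \<Rightarrow> epoint" where
  "meet L M = (THE X. X \<in> L \<and> X \<in> M)"

text \<open>As usual in affine geometry, a line is parallel to itself.\<close>

definition parallel :: "epoint set \<Rightarrow> epoint set \<Rightarrow> bool" where
  "parallel L M \<longleftrightarrow> is_line L \<and> is_line M \<and> L \<noteq> line_at_infinity \<and> M \<noteq> line_at_infinity
     \<and> L \<inter> M \<inter> line_at_infinity \<noteq> {}"

definition parallel_through :: "epoint \<Rightarrow> epoint set \<Rightarrow> epoint set" where
  "parallel_through X L = (THE M. X \<in> M \<and> parallel M L)"

text \<open>
  For \<open>X = (x, s)\<close> and \<open>Y = (y, t)\<close> the midpoint (the harmonic conjugate, with respect to
  \<open>X, Y\<close>, of the point at infinity of \<open>XY\<close>) is \<open>(t x + s y, 2 s t)\<close>; this is the ordinary midpoint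
  of two ordinary points, and it is the infinite point itself if exactly one of \<open>X, Y\<close> is infinite.
\<close>

definition emidpoint :: "epoint \<Rightarrow> epoint \<Rightarrow> epoint" where
  "emidpoint X Y = (case rep_epoint X of (x, s) \<Rightarrow> case rep_epoint Y of (y, t) \<Rightarrow>
     abs_epoint (t *\<^sub>R x + s *\<^sub>R y, 2 * s * t))"


section \<open>Affine maps\<close>

definition affine_map :: "(real^2 \<Rightarrow> real^2) \<Rightarrow> bool" where
  "affine_map f \<longleftrightarrow> linear (\<lambda>x. f x - f 0)"

text \<open>The action of a bijective affine map on the extended plane.\<close>

definition ext :: "(real^2 \<Rightarrow> real^2) \<Rightarrow> epoint \<Rightarrow> epoint" where
  "ext f X = (case rep_epoint X of (x, s) \<Rightarrow> abs_epoint ((f x - f 0) + s *\<^sub>R f 0, s))"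

definition homothety :: "real^2 \<Rightarrow> real \<Rightarrow> real^2 \<Rightarrow> real^2" where
  "homothety c r x = c + r *\<^sub>R (x - c)"

definition is_translation :: "(real^2 \<Rightarrow> real^2) \<Rightarrow> bool" where
  "is_translation f \<longleftrightarrow> (\<exists>v. \<forall>x. f x = x + v)"


section \<open>Conics\<close>

text \<open>A conic is the zero set of a nondegenerate quadratic form; the form is kept as its polar form.\<close>

definition conic_form :: "((real^2) \<times> real \<Rightarrow> (real^2) \<times> real \<Rightarrow> real) \<Rightarrow> bool" where
  "conic_form b \<longleftrightarrow> bilinear b \<and> (\<forall>v w. b v w = b w v) \<and> (\<forall>v. (\<forall>w. b v w = 0) \<longrightarrow> v = 0)"

definition conic_of :: "((real^2) \<times> real \<Rightarrow> (real^2) \<times> real \<Rightarrow> real) \<Rightarrow> epoint set" where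
  "conic_of b = {X. b (rep_epoint X) (rep_epoint X) = 0}"

definition polar :: "((real^2) \<times> real \<Rightarrow> (real^2) \<times> real \<Rightarrow> real) \<Rightarrow> epoint \<Rightarrow> epoint set" where
  "polar b X = {Y. b (rep_epoint X) (rep_epoint Y) = 0}"

definition conic_center :: "((real^2) \<times> real \<Rightarrow> (real^2) \<times> real \<Rightarrow> real) \<Rightarrow> epoint \<Rightarrow> bool" where
  "conic_center b Z \<longleftrightarrow> polar b Z = line_at_infinity"

definition conic_tangent_at ::
    "((real^2) \<times> real \<Rightarrow> (real^2) \<times> real \<Rightarrow> real) \<Rightarrow> epoint set \<Rightarrow> epoint \<Rightarrow> bool" where
  "conic_tangent_at b L X \<longleftrightarrow> X \<in> conic_of b \<and> polar b X = L"

definition nine_point_conic :: "epoint \<Rightarrow> epoint \<Rightarrow> epoint \<Rightarrow> epoint \<Rightarrow> epoint set" where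
  "nine_point_conic W X Y Z = (THE N. (\<exists>b. conic_form b \<and> N = conic_of b) \<and>
     {emidpoint W X, emidpoint W Y, emidpoint W Z, emidpoint X Y, emidpoint X Z, emidpoint Y Z,
      meet (join W X) (join Y Z), meet (join W Y) (join X Z), meet (join W Z) (join X Y)} \<subseteq> N)"


section \<open>Triangle geometry\<close>

definition bary :: "real^2 \<Rightarrow> real^2 \<Rightarrow> real^2 \<Rightarrow> real \<Rightarrow> real \<Rightarrow> real \<Rightarrow> epoint" where
  "bary A B C x y z = abs_epoint (x *\<^sub>R hom A + y *\<^sub>R hom B + z *\<^sub>R hom C)"

text \<open>The isotomic map, for points off the sides of \<open>ABC\<close>.\<close>

definition isotomic :: "real^2 \<Rightarrow> real^2 \<Rightarrow> real^2 \<Rightarrow> epoint \<Rightarrow> epoint" where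
  "isotomic A B C P = (THE R. \<exists>x y z. x \<noteq> 0 \<and> y \<noteq> 0 \<and> z \<noteq> 0 \<and>
     P = bary A B C x y z \<and> R = bary A B C (1 / x) (1 / y) (1 / z))"

definition bary_line :: "real^2 \<Rightarrow> real^2 \<Rightarrow> real^2 \<Rightarrow> real \<Rightarrow> real \<Rightarrow> real \<Rightarrow> epoint set" where
  "bary_line A B C p q r =
     {bary A B C x y z | x y z. (x, y, z) \<noteq> (0, 0, 0) \<and> p * x + q * y + r * z = 0}"

definition isotomic_line :: "real^2 \<Rightarrow> real^2 \<Rightarrow> real^2 \<Rightarrow> epoint set \<Rightarrow> epoint set" where
  "isotomic_line A B C L =
     {bary A B C x y z | x y z. (x, y, z) \<noteq> (0, 0, 0) \<and>
        (\<exists>p q r. (p, q, r) \<noteq> (0, 0, 0) \<and> L = bary_line A B C p q r \<and>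
           p * y * z + q * z * x + r * x * y = 0)}"

definition centroid :: "real^2 \<Rightarrow> real^2 \<Rightarrow> real^2 \<Rightarrow> real^2" where
  "centroid A B C = (1 / 3) *\<^sub>R (A + B + C)"

definition complement :: "real^2 \<Rightarrow> real^2 \<Rightarrow> real^2 \<Rightarrow> real^2 \<Rightarrow> real^2" where
  "complement A B C = homothety (centroid A B C) (- 1 / 2)"

definition on_sides :: "real^2 \<Rightarrow> real^2 \<Rightarrow> real^2 \<Rightarrow> epoint \<Rightarrow> bool" where
  "on_sides A B C P \<longleftrightarrow>
     P \<in> join (ord_pt B) (ord_pt C) \<union> join (ord_pt C) (ord_pt A) \<union> join (ord_pt A) (ord_pt B)"

text \<open>\<open>trace_on A B C P\<close> is \<open>AP \<inter> BC\<close>.\<close>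

definition trace_on :: "real^2 \<Rightarrow> real^2 \<Rightarrow> real^2 \<Rightarrow> epoint \<Rightarrow> epoint" where
  "trace_on A B C P = meet (join (ord_pt A) P) (join (ord_pt B) (ord_pt C))"

text \<open>The map \<open>T\<^sub>P\<close>; the traces are ordinary for \<open>P\<close> off the sides of the anticomplementary triangle.\<close>

definition cevian_map :: "real^2 \<Rightarrow> real^2 \<Rightarrow> real^2 \<Rightarrow> epoint \<Rightarrow> real^2 \<Rightarrow> real^2" where
  "cevian_map A B C P = (THE f. affine_map f \<and> ord_pt (f A) = trace_on A B C P \<and>
     ord_pt (f B) = trace_on B C A P \<and> ord_pt (f C) = trace_on C A B P)"

text \<open>The point \<open>Q = K(\<iota>(P))\<close>.\<close>

definition isotomcomplement :: "real^2 \<Rightarrow> real^2 \<Rightarrow> real^2 \<Rightarrow> epoint \<Rightarrow> epoint" where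
  "isotomcomplement A B C P = ext (complement A B C) (isotomic A B C P)"

definition generalized_orthocenter ::
    "real^2 \<Rightarrow> real^2 \<Rightarrow> real^2 \<Rightarrow> epoint \<Rightarrow> epoint \<Rightarrow> bool" where
  "generalized_orthocenter A B C P H \<longleftrightarrow> (let Q = isotomcomplement A B C P in
     (H \<noteq> ord_pt A \<longrightarrow> parallel (join H (ord_pt A)) (join Q (trace_on A B C P))) \<and>
     (H \<noteq> ord_pt B \<longrightarrow> parallel (join H (ord_pt B)) (join Q (trace_on B C A P))) \<and>
     (H \<noteq> ord_pt C \<longrightarrow> parallel (join H (ord_pt C)) (join Q (trace_on C A B P))))"

text \<open>The inconic of \<open>ABC\<close> with center \<open>Q\<close>, touching the sides at the traces of \<open>P\<close>.\<close>

definition inconic :: "real^2 \<Rightarrow> real^2 \<Rightarrow> real^2 \<Rightarrow> epoint \<Rightarrow> epoint set" where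
  "inconic A B C P = (THE I. \<exists>b. conic_form b \<and> I = conic_of b \<and>
     conic_center b (isotomcomplement A B C P) \<and>
     conic_tangent_at b (join (ord_pt B) (ord_pt C)) (trace_on A B C P) \<and>
     conic_tangent_at b (join (ord_pt C) (ord_pt A)) (trace_on B C A P) \<and>
     conic_tangent_at b (join (ord_pt A) (ord_pt B)) (trace_on C A B P))"

end

theory Submission
  imports Defs
begin

text \<open>
  Every object in the statement becomes rational in homogeneous barycentric coordinates with
  respect to \<open>ABC\<close>, so the proof finds the coordinates of \<open>P\<close> and then reads off each claim.

  Write \<open>P = (p : q : r)\<close>, so \<open>P' = (qr : rp : pq)\<close>. The trace of \<open>P'\<close> on \<open>BC\<close> is the midpoint of
  \<open>AP'\<close> exactly if \<open>2qr + rp + pq = 0\<close>. For \<open>H = A\<close> the line \<open>QE\<close> is parallel to \<open>AB\<close>, which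
  means \<open>q (r + p) = p (p - r)\<close>. Together these give \<open>q + r = 2p\<close> and \<open>qr = -p\<^sup>2\<close>, hence
  \<open>P = (1 : 1 - t : 1 + t)\<close> with \<open>t\<^sup>2 = 2\<close> (\<open>point_determined\<close>). It follows that
  \<open>P' = (-1 : 1 + t : 1 - t)\<close> and \<open>Q = (2 : -t : t)\<close>.

  Lines: the complement map is \<open>(x : y : z) \<mapsto> (y + z : z + x : x + y)\<close>, and applying its
  inverse to lines takes \<open>BC\<close>, that is \<open>x = 0\<close>, to \<open>y + z = 0\<close>, which is \<open>AQ\<close>, and this to
  \<open>2x + y + z = 0\<close>, which is \<open>l\<close>.

  Conics: a conic through the nine points of the quadrangle, or tangent to the three sides at
  given points, has its quadratic form determined up to a factor by linear conditions, so the
  definite descriptions in the definitions have explicit values (\<open>nine_point_conic_eq\<close>,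
  \<open>inconic_eq\<close>). Substituting the matrix of \<open>T\<close> for \<open>P'\<close> in the nine-point conic gives
  \<open>2yz + zx + xy = 0\<close>, the isotomic image of \<open>l\<close> (\<open>circumconic_eq\<close>). In coordinates of sum 1 the
  map \<open>M\<close> adds the constant vector \<open>(1, -(1 + t)/2, -(1 - t)/2)\<close> of sum 0, so it is a
  translation, and substituting it in the inconic gives the circumconic back (\<open>M_image\<close>).

  Points: \<open>O = (0 : 1 : 1)\<close>, and in coordinates of sum 1 one has \<open>P' - O = -3 (P - O)\<close> and
  \<open>O' - O = -2 (P - O)\<close>. The line \<open>l\<^sub>G\<close> is \<open>y + z = 2x\<close>; on it the circumconic becomes
  \<open>(y - x)\<^sup>2 = 2x\<^sup>2\<close>, whose two solutions correspond to the two square roots \<open>t\<close> of 2, and \<open>P\<close>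
  is one of them.
\<close>

section \<open>Representatives and proportional triples\<close>

lemma proj_rel_self: "proj_rel v v \<longleftrightarrow> v \<noteq> 0"
  unfolding proj_rel_def by (auto intro: exI[of _ 1])

lemma rep_epoint_nonzero: "rep_epoint X \<noteq> 0"
  using Quotient3_rep_reflp[OF Quotient3_epoint] proj_rel_self by blast

lemma abs_rep_epoint: "abs_epoint (rep_epoint X) = X"
  by (rule Quotient3_abs_rep[OF Quotient3_epoint])

lemma rep_abs_epoint:
  assumes "v \<noteq> 0"
  obtains k where "k \<noteq> 0" "rep_epoint (abs_epoint v) = k *\<^sub>R v"
proof -
  have "proj_rel v (rep_epoint (abs_epoint v))"
    using Quotient3_rep_abs[OF Quotient3_epoint] assms proj_rel_self part_equivp_proj_rel
    by (meson part_equivp_symp)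
  then show ?thesis using that unfolding proj_rel_def by blast
qed

lemma abs_epoint_eq_iff:
  assumes "v \<noteq> 0" "w \<noteq> 0"
  shows "abs_epoint v = abs_epoint w \<longleftrightarrow> (\<exists>k. k \<noteq> 0 \<and> w = k *\<^sub>R v)"
  using Quotient3_rel[OF Quotient3_epoint, of v w] assms
  by (auto simp: proj_rel_self) (auto simp: proj_rel_def)

lemma proportional_iff_cross_zero:
  fixes a b c x y z :: real
  assumes "a \<noteq> 0 \<or> b \<noteq> 0 \<or> c \<noteq> 0" "x \<noteq> 0 \<or> y \<noteq> 0 \<or> z \<noteq> 0"
  shows "(\<exists>k. k \<noteq> 0 \<and> x = k * a \<and> y = k * b \<and> z = k * c)
    \<longleftrightarrow> b * z = c * y \<and> c * x = a * z \<and> a * y = b * x" (is "?L \<longleftrightarrow> ?R")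
proof
  assume ?R
  consider "a \<noteq> 0" | "b \<noteq> 0" | "c \<noteq> 0" using assms(1) by blast
  then show ?L
  proof cases
    case 1 then show ?thesis using \<open>?R\<close> assms(2)
      by (intro exI[of _ "x / a"]) (auto simp: field_simps)
  next
    case 2 then show ?thesis using \<open>?R\<close> assms(2)
      by (intro exI[of _ "y / b"]) (auto simp: field_simps)
  next
    case 3 then show ?thesis using \<open>?R\<close> assms(2)
      by (intro exI[of _ "z / c"]) (auto simp: field_simps)
  qed
qed auto

text \<open>
  A triple orthogonal to two others is parallel to their cross product. This gives the uniqueness
  of the join of two points and, dually, of the meet of two lines.
\<close>

lemma orthogonal_to_two_imp_cross:
  fixes p q r :: real
  assumes "p * a + q * b + r * c = 0" "p * d + q * e + r * f = 0"
  shows "q * (a * e - b * d) = r * (c * d - a * f)"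
    "r * (b * f - c * e) = p * (a * e - b * d)"
    "p * (c * d - a * f) = q * (b * f - c * e)"
  using assms by algebra+

text \<open>
  By Cramer's rule the determinant multiplied by each unknown vanishes.
\<close>

lemma orthogonal_to_three_imp_det:
  fixes x y z :: real
  assumes "x \<noteq> 0 \<or> y \<noteq> 0 \<or> z \<noteq> 0"
    and "a * x + b * y + c * z = 0" "d * x + e * y + f * z = 0" "g * x + h * y + i * z = 0"
  shows "a * (e * i - f * h) - b * (d * i - f * g) + c * (d * h - e * g) = 0" (is "?d = 0")
proof -
  have "?d * x = 0" "?d * y = 0" "?d * z = 0" using assms(2-) by algebra+
  then show ?thesis using assms(1) by auto
qed

section \<open>Barycentric coordinates\<close>

locale triangle =
  fixes A B C :: "real^2"
  assumes nondegenerate: "\<not> collinear {A, B, C}"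
begin

definition hvec :: "real \<Rightarrow> real \<Rightarrow> real \<Rightarrow> (real^2) \<times> real" where
  "hvec x y z = x *\<^sub>R hom A + y *\<^sub>R hom B + z *\<^sub>R hom C"

abbreviation "pnt \<equiv> bary A B C"
abbreviation "lin \<equiv> bary_line A B C"

lemma pnt_eq: "pnt x y z = abs_epoint (hvec x y z)"
  by (simp add: bary_def hvec_def)

lemma hvec_components: "hvec x y z = (x *\<^sub>R A + y *\<^sub>R B + z *\<^sub>R C, x + y + z)"
  by (simp add: hvec_def hom_def)

lemma hvec_scale: "k *\<^sub>R hvec x y z = hvec (k * x) (k * y) (k * z)"
  by (simp add: hvec_def scaleR_add_right)

lemma hvec_add: "hvec x y z + hvec x' y' z' = hvec (x + x') (y + y') (z + z')"
  by (simp add: hvec_def scaleR_add_left)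

text \<open>
  Twice the signed area of \<open>ABC\<close>, the denominator in Cramer's rule for the coordinates below.
\<close>

definition area2 :: real where
  "area2 = (B - A) $ 1 * (C - A) $ 2 - (B - A) $ 2 * (C - A) $ 1"

lemma area2_nonzero: "area2 \<noteq> 0"
proof
  assume d: "area2 = 0"
  define b c where "b = B - A" and "c = C - A"
  have d': "b $ 1 * c $ 2 = b $ 2 * c $ 1"
    using d by (simp add: area2_def b_def c_def)
  have "collinear {0, b, c}"
  proof (cases "b $ 1 = 0 \<and> b $ 2 = 0")
    case True
    then have "b = 0" unfolding vec_eq_iff forall_2 by simp
    then show ?thesis by (simp add: collinear_lemma)
  next
    case False
    have "c = (c $ 1 / b $ 1) *\<^sub>R b" if "b $ 1 \<noteq> 0"
      using that d' unfolding vec_eq_iff forall_2 by (simp add: field_simps)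
    moreover have "c = (c $ 2 / b $ 2) *\<^sub>R b" if "b $ 2 \<noteq> 0"
      using that d' unfolding vec_eq_iff forall_2 by (simp add: field_simps)
    ultimately show ?thesis using False by (auto simp: collinear_lemma)
  qed
  then have "collinear {B, A, C}" using collinear_3[of B A C] by (simp add: b_def c_def)
  then show False using nondegenerate by (simp add: insert_commute)
qed

text \<open>
  \<open>crdA\<close>, \<open>crdB\<close>, \<open>crdC\<close> form the basis dual to \<open>hom A\<close>, \<open>hom B\<close>, \<open>hom C\<close>; the formulas solve
  \<open>u - s A = y (B - A) + z (C - A)\<close> for \<open>y\<close> and \<open>z\<close>.
\<close>

definition crdB :: "(real^2) \<times> real \<Rightarrow> real" where
  "crdB v = ((fst v - snd v *\<^sub>R A) $ 1 * (C - A) $ 2 - (fst v - snd v *\<^sub>R A) $ 2 * (C - A) $ 1) / area2"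

definition crdC :: "(real^2) \<times> real \<Rightarrow> real" where
  "crdC v = ((B - A) $ 1 * (fst v - snd v *\<^sub>R A) $ 2 - (B - A) $ 2 * (fst v - snd v *\<^sub>R A) $ 1) / area2"

definition crdA :: "(real^2) \<times> real \<Rightarrow> real" where
  "crdA v = snd v - crdB v - crdC v"

lemma linear_coordinates: "linear crdA" "linear crdB" "linear crdC"
proof -
  show *: "linear crdB" "linear crdC"
    by (auto intro!: linearI simp: crdB_def crdC_def add_divide_distrib[symmetric] algebra_simps)
  show "linear crdA" unfolding crdA_def
    by (intro linear_compose_sub * linear_snd)
qed

lemma coordinates_hvec: "crdA (hvec x y z) = x" "crdB (hvec x y z) = y" "crdC (hvec x y z) = z"
proof -
  show *: "crdB (hvec x y z) = y" "crdC (hvec x y z) = z"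
    using area2_nonzero
    by (simp_all add: crdB_def crdC_def hvec_components divide_eq_eq)
      (simp_all add: area2_def algebra_simps)
  show "crdA (hvec x y z) = x" by (simp add: crdA_def *) (simp add: hvec_components)
qed

text \<open>
  Every homogeneous vector is a combination of those of the vertices, so every point of the
  extended plane has barycentric coordinates.
\<close>

lemma hvec_coordinates: "hvec (crdA v) (crdB v) (crdC v) = v"
proof -
  have cramer: "(w1 * c2 - w2 * c1) / d * b1 + (b1 * w2 - b2 * w1) / d * c1 = w1"
      "(w1 * c2 - w2 * c1) / d * b2 + (b1 * w2 - b2 * w1) / d * c2 = w2"
    if "d = b1 * c2 - b2 * c1" "d \<noteq> 0" for w1 w2 b1 b2 c1 c2 d :: real
  proof -
    have "(w1 * c2 - w2 * c1) * b1 + (b1 * w2 - b2 * w1) * c1 = w1 * d"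
      "(w1 * c2 - w2 * c1) * b2 + (b1 * w2 - b2 * w1) * c2 = w2 * d"
      unfolding that(1) by algebra+
    then show "(w1 * c2 - w2 * c1) / d * b1 + (b1 * w2 - b2 * w1) / d * c1 = w1"
      "(w1 * c2 - w2 * c1) / d * b2 + (b1 * w2 - b2 * w1) / d * c2 = w2"
      using that(2) by (simp_all add: add_divide_distrib[symmetric] divide_eq_eq)
  qed
  have "crdB v *\<^sub>R (B - A) + crdC v *\<^sub>R (C - A) = fst v - snd v *\<^sub>R A"
    unfolding vec_eq_iff forall_2 vector_add_component vector_scaleR_component
      real_scaleR_def crdB_def crdC_def
    using cramer[OF area2_def area2_nonzero] by blast
  then show ?thesis
    by (simp add: prod_eq_iff hvec_components crdA_def algebra_simps)
qed

lemma hvec_eq_iff: "hvec x y z = hvec x' y' z' \<longleftrightarrow> x = x' \<and> y = y' \<and> z = z'"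
  by (metis coordinates_hvec)

lemma hvec_eq_0_iff: "hvec x y z = 0 \<longleftrightarrow> x = 0 \<and> y = 0 \<and> z = 0"
proof -
  have "hvec 0 0 0 = 0" by (simp add: hvec_def)
  then show ?thesis using hvec_eq_iff[of x y z 0 0 0] by simp
qed

lemma epoint_cases:
  obtains x y z where "x \<noteq> 0 \<or> y \<noteq> 0 \<or> z \<noteq> 0" "X = pnt x y z"
  by (metis abs_rep_epoint hvec_coordinates hvec_eq_0_iff pnt_eq rep_epoint_nonzero)

lemma rep_pnt:
  assumes "x \<noteq> 0 \<or> y \<noteq> 0 \<or> z \<noteq> 0"
  obtains k where "k \<noteq> 0" "rep_epoint (pnt x y z) = k *\<^sub>R hvec x y z"
  using rep_abs_epoint[of "hvec x y z"] assms unfolding pnt_eq hvec_eq_0_iff by metis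

lemma pnt_eq_iff:
  assumes "a \<noteq> 0 \<or> b \<noteq> 0 \<or> c \<noteq> 0" "x \<noteq> 0 \<or> y \<noteq> 0 \<or> z \<noteq> 0"
  shows "pnt a b c = pnt x y z \<longleftrightarrow> b * z = c * y \<and> c * x = a * z \<and> a * y = b * x"
  using assms by (simp add: pnt_eq abs_epoint_eq_iff hvec_eq_0_iff hvec_scale hvec_eq_iff
      proportional_iff_cross_zero[OF assms, symmetric])

lemma ord_pt_vertices: "ord_pt A = pnt 1 0 0" "ord_pt B = pnt 0 1 0" "ord_pt C = pnt 0 0 1"
  by (simp_all add: ord_pt_def bary_def)

lemma pnt_in_lin_iff:
  assumes "x \<noteq> 0 \<or> y \<noteq> 0 \<or> z \<noteq> 0"
  shows "pnt x y z \<in> lin p q r \<longleftrightarrow> p * x + q * y + r * z = 0"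
proof
  assume "pnt x y z \<in> lin p q r"
  then obtain a b c where nz: "a \<noteq> 0 \<or> b \<noteq> 0 \<or> c \<noteq> 0" and eq: "pnt x y z = pnt a b c"
    and l: "p * a + q * b + r * c = 0"
    unfolding bary_line_def by auto
  obtain k where "x = k * a" "y = k * b" "z = k * c"
    using eq pnt_eq_iff[OF nz assms] proportional_iff_cross_zero[OF nz assms] by metis
  then have "p * x + q * y + r * z = k * (p * a + q * b + r * c)" by algebra
  then show "p * x + q * y + r * z = 0" using l by simp
qed (use assms in \<open>auto simp: bary_line_def\<close>)

lemma set_eq_by_coordinates:
  assumes "\<And>x y z. x \<noteq> 0 \<or> y \<noteq> 0 \<or> z \<noteq> 0 \<Longrightarrow> pnt x y z \<in> S \<longleftrightarrow> pnt x y z \<in> T"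
  shows "S = T"
proof (rule set_eqI)
  fix X show "X \<in> S \<longleftrightarrow> X \<in> T" using epoint_cases[of X] assms by metis
qed

text \<open>
  The chosen representative of a point is an unknown multiple of \<open>hvec x y z\<close>, and the vanishing
  of a linear form does not depend on that multiple.
\<close>

lemma functional_vanishes_at_pnt:
  assumes "linear f" "x \<noteq> 0 \<or> y \<noteq> 0 \<or> z \<noteq> 0"
  shows "f (rep_epoint (pnt x y z)) = 0 \<longleftrightarrow> f (hom A) * x + f (hom B) * y + f (hom C) * z = (0::real)"
proof -
  obtain k where "k \<noteq> 0" "rep_epoint (pnt x y z) = k *\<^sub>R hvec x y z" using rep_pnt[OF assms(2)] .
  then show ?thesis
    by (simp add: hvec_def linear_add[OF assms(1)] linear_scale[OF assms(1)] mult.commute)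
qed

lemma zero_set_of_functional:
  fixes f :: "(real^2) \<times> real \<Rightarrow> real"
  assumes "linear f"
  shows "{X. f (rep_epoint X) = 0} = lin (f (hom A)) (f (hom B)) (f (hom C))"
  by (rule set_eq_by_coordinates) (simp add: functional_vanishes_at_pnt[OF assms] pnt_in_lin_iff)

lemma vertex_homs: "hom A = hvec 1 0 0" "hom B = hvec 0 1 0" "hom C = hvec 0 0 1"
  by (simp_all add: hvec_def)

section \<open>Lines, joins and meets\<close>

text \<open>
  A linear form in the barycentric coordinates is the inner product with some fixed vector.
\<close>

lemma is_line_lin:
  assumes "p \<noteq> 0 \<or> q \<noteq> 0 \<or> r \<noteq> 0"
  shows "is_line (lin p q r)"
proof -
  define f where "f = (\<lambda>v. p * crdA v + q * crdB v + r * crdC v)"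
  have lf: "linear f" unfolding f_def
    by (intro linearI; simp add: linear_coordinates[THEN linear_add]
        linear_coordinates[THEN linear_scale] algebra_simps)
  have f: "f v = inner (adjoint f 1) v" for v
    using adjoint_works[OF lf, of v 1] by (simp add: inner_commute)
  have val: "f (hom A) = p" "f (hom B) = q" "f (hom C) = r"
    by (simp_all add: f_def vertex_homs coordinates_hvec)
  have "lin p q r = {X. f (rep_epoint X) = 0}"
    using zero_set_of_functional[OF lf] by (simp add: val)
  then have "lin p q r = {X. inner (adjoint f 1) (rep_epoint X) = 0}" by (simp add: f)
  moreover have "adjoint f 1 \<noteq> 0" using val f assms by (metis inner_zero_left)
  ultimately show ?thesis unfolding is_line_def by blast
qed

lemma is_line_cases:
  assumes "is_line L"
  obtains p q r where "p \<noteq> 0 \<or> q \<noteq> 0 \<or> r \<noteq> 0" "L = lin p q r"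
proof -
  obtain u where u: "u \<noteq> 0" "L = {X. inner u (rep_epoint X) = 0}"
    using assms unfolding is_line_def by blast
  have l: "linear (inner u)" by (rule bounded_linear.linear[OF bounded_linear_inner_right])
  have "inner u u \<noteq> 0" using u by simp
  moreover have "inner u (hvec x y z) = x * inner u (hom A) + y * inner u (hom B) + z * inner u (hom C)" for x y z
    by (simp add: hvec_def inner_add_right)
  ultimately have "inner u (hom A) \<noteq> 0 \<or> inner u (hom B) \<noteq> 0 \<or> inner u (hom C) \<noteq> 0"
    using hvec_coordinates[of u] by (metis add.right_neutral mult_zero_right)
  then show ?thesis using that u zero_set_of_functional[OF l] by blast
qed

lemma lin_eq_iff:
  assumes "a \<noteq> 0 \<or> b \<noteq> 0 \<or> c \<noteq> 0" "p \<noteq> 0 \<or> q \<noteq> 0 \<or> r \<noteq> 0"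
  shows "lin a b c = lin p q r \<longleftrightarrow> b * r = c * q \<and> c * p = a * r \<and> a * q = b * p" (is "?L \<longleftrightarrow> ?R")
proof
  assume ?L
  \<comment> \<open>The points where \<open>(a, b, c)\<close> meets the sides are \<open>(0, c, -b)\<close>, \<open>(-c, 0, a)\<close>, \<open>(b, -a, 0)\<close>.\<close>
  have "x \<noteq> 0 \<or> y \<noteq> 0 \<or> z \<noteq> 0 \<Longrightarrow> a * x + b * y + c * z = 0 \<Longrightarrow> p * x + q * y + r * z = 0" for x y z
    using \<open>?L\<close> pnt_in_lin_iff by blast
  from this[of 0 c "-b"] this[of "-c" 0 a] this[of b "-a" 0]
  show ?R by (cases "a = 0"; cases "b = 0"; cases "c = 0"; simp add: algebra_simps)
next
  assume ?R
  then obtain k where "k \<noteq> 0" "p = k * a" "q = k * b" "r = k * c"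
    using proportional_iff_cross_zero[OF assms] by metis
  then have "p * x + q * y + r * z = k * (a * x + b * y + c * z)" "k \<noteq> 0" for x y z
    by (auto simp: algebra_simps)
  then show ?L by (intro set_eq_by_coordinates) (simp add: pnt_in_lin_iff)
qed

lemma join_pnt:
  assumes "b * f - c * e \<noteq> 0 \<or> c * d - a * f \<noteq> 0 \<or> a * e - b * d \<noteq> 0"
  shows "join (pnt a b c) (pnt d e f) = lin (b * f - c * e) (c * d - a * f) (a * e - b * d)"
  unfolding join_def
proof (rule the_equality)
  have nz: "a \<noteq> 0 \<or> b \<noteq> 0 \<or> c \<noteq> 0" "d \<noteq> 0 \<or> e \<noteq> 0 \<or> f \<noteq> 0" using assms by auto
  show "is_line (lin (b * f - c * e) (c * d - a * f) (a * e - b * d)) \<and>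
    pnt a b c \<in> lin (b * f - c * e) (c * d - a * f) (a * e - b * d) \<and>
    pnt d e f \<in> lin (b * f - c * e) (c * d - a * f) (a * e - b * d)"
    using nz assms is_line_lin by (simp add: pnt_in_lin_iff algebra_simps)
  fix L assume L: "is_line L \<and> pnt a b c \<in> L \<and> pnt d e f \<in> L"
  then obtain p q r where p: "p \<noteq> 0 \<or> q \<noteq> 0 \<or> r \<noteq> 0" and Leq: "L = lin p q r"
    using is_line_cases by blast
  have "p * a + q * b + r * c = 0" "p * d + q * e + r * f = 0"
    using L nz by (auto simp: Leq pnt_in_lin_iff)
  from orthogonal_to_two_imp_cross[OF this]
  show "L = lin (b * f - c * e) (c * d - a * f) (a * e - b * d)"
    by (simp add: Leq lin_eq_iff[OF p assms])
qed

lemma meet_lin: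
  assumes "b * f - c * e \<noteq> 0 \<or> c * d - a * f \<noteq> 0 \<or> a * e - b * d \<noteq> 0"
  shows "meet (lin a b c) (lin d e f) = pnt (b * f - c * e) (c * d - a * f) (a * e - b * d)"
  unfolding meet_def
proof (rule the_equality)
  show "pnt (b * f - c * e) (c * d - a * f) (a * e - b * d) \<in> lin a b c \<and>
    pnt (b * f - c * e) (c * d - a * f) (a * e - b * d) \<in> lin d e f"
    using assms by (simp add: pnt_in_lin_iff algebra_simps)
  fix X assume X: "X \<in> lin a b c \<and> X \<in> lin d e f"
  obtain p q r where p: "p \<noteq> 0 \<or> q \<noteq> 0 \<or> r \<noteq> 0" and Xeq: "X = pnt p q r"
    using epoint_cases by blast
  have "p * a + q * b + r * c = 0" "p * d + q * e + r * f = 0"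
    using X p by (auto simp: Xeq pnt_in_lin_iff mult.commute)
  from orthogonal_to_two_imp_cross[OF this]
  show "X = pnt (b * f - c * e) (c * d - a * f) (a * e - b * d)"
    by (simp add: Xeq pnt_eq_iff[OF p assms])
qed

lemma line_at_infinity_eq: "line_at_infinity = lin 1 1 1"
  using zero_set_of_functional[OF linear_snd] by (simp add: line_at_infinity_def hom_def)

end

section \<open>Affine maps on the extended plane\<close>

text \<open>
  The linear map on homogeneous vectors that induces \<open>ext f\<close>.
\<close>

definition lift :: "(real^2 \<Rightarrow> real^2) \<Rightarrow> (real^2) \<times> real \<Rightarrow> (real^2) \<times> real" where
  "lift f v = ((f (fst v) - f 0) + snd v *\<^sub>R f 0, snd v)"

lemma ext_eq_lift: "ext f X = abs_epoint (lift f (rep_epoint X))"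
  by (simp add: ext_def lift_def split: prod.split)

lemma lift_hom: "lift f (hom x) = hom (f x)"
  by (simp add: lift_def hom_def)

lemma linear_lift: 
  assumes "affine_map f"
  shows "linear (lift f)"
proof -
  have l: "linear (\<lambda>x. f x - f 0)" using assms by (simp add: affine_map_def)
  have s: "f (r *\<^sub>R x) - f 0 = r *\<^sub>R (f x - f 0)" for r x using linear_scale[OF l] by simp
  have a: "f (x + y) - f 0 = (f x - f 0) + (f y - f 0)" for x y using linear_add[OF l] by simp
  show ?thesis
    unfolding lift_def by (rule linearI; simp add: a s prod_eq_iff; simp add: algebra_simps)
qed

lemma affine_map_comp:
  assumes "affine_map f" "affine_map g"
  shows "affine_map (f \<circ> g)"
proof -
  have l: "linear (\<lambda>x. f x - f 0)" "linear (\<lambda>x. g x - g 0)"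
    using assms by (simp_all add: affine_map_def)
  have "f (g x) - f (g 0) = f (g x - g 0) - f 0" for x
    using linear_diff[OF l(1), of "g x" "g 0"] by simp
  then show ?thesis unfolding affine_map_def comp_def
    using linear_compose[OF l(2,1)] by (simp add: comp_def)
qed

lemma lift_comp:
  assumes "affine_map f"
  shows "lift (f \<circ> g) v = lift f (lift g v)"
proof -
  have l: "linear (\<lambda>x. f x - f 0)" using assms by (simp add: affine_map_def)
  have "f (g x - g 0 + s *\<^sub>R g 0) - f 0 = f (g x) - f (g 0) + s *\<^sub>R (f (g 0) - f 0)" for x s
    using linear_add[OF l, of "g x - g 0" "s *\<^sub>R g 0"] linear_diff[OF l, of "g x" "g 0"]
      linear_scale[OF l, of s "g 0"] by simp
  then show ?thesis by (simp add: lift_def prod_eq_iff algebra_simps)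
qed

lemma lift_id: "lift id v = v"
  by (simp add: lift_def)

lemma ext_id: "ext id X = X"
  by (simp add: ext_eq_lift lift_id abs_rep_epoint)

text \<open>
  For a bijection the lift sends nonzero vectors to nonzero vectors, so that \<open>ext f\<close> is computed on
  any representative of a point.
\<close>

lemma lift_eq_0_iff:
  assumes "bij f"
  shows "lift f v = 0 \<longleftrightarrow> v = 0"
  using inj_eq[OF bij_is_inj[OF assms], of "fst v" 0]
  by (auto simp: lift_def prod_eq_iff)

text \<open>
  Vectors at infinity, of the form \<open>(x, 0)\<close>, carry the linear part of \<open>f\<close>; if the lift kills none
  of them, then the linear part is injective, hence bijective in finite dimension.
\<close>

lemma bij_affine_if_lift_injective:
  assumes "affine_map f" "\<And>v. lift f v = 0 \<Longrightarrow> v = 0"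
  shows "bij f"
proof -
  define g where "g = (\<lambda>x. f x - f 0)"
  have l: "linear g" using assms by (simp add: affine_map_def g_def)
  have "x = 0" if "g x = 0" for x
    using assms(2)[of "(x, 0)"] that by (simp add: lift_def g_def prod_eq_iff)
  then have "inj g" using linear_injective_0[OF l] by blast
  then have "bij g" using linear_injective_imp_surjective[OF l] by (simp add: bij_def)
  then have "bij ((\<lambda>x. x + f 0) \<circ> g)"
    by (intro bij_comp) (auto intro!: bij_plus_right)
  then show ?thesis by (simp add: g_def comp_def)
qed

lemma affine_map_inv:
  assumes "affine_map f" "bij f"
  shows "affine_map (inv f)"
proof -
  define g where "g = (\<lambda>x. f x - f 0)"
  have l: "linear g" using assms by (simp add: affine_map_def g_def)
  have injf: "inj f" and surjf: "surj f" using assms(2) by (auto simp: bij_def)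
  have "inj g" using injf by (simp add: g_def inj_def)
  obtain h where h: "linear h" "h \<circ> g = id" using linear_injective_left_inverse[OF l \<open>inj g\<close>] by blast
  have "inv f y - inv f 0 = h y" for y
  proof -
    have "g (inv f y - inv f 0) = g (inv f y) - g (inv f 0)" by (rule linear_diff[OF l])
    also have "\<dots> = y" using surjf by (simp add: g_def surj_f_inv_f)
    finally show ?thesis using h(2) by (metis comp_apply id_apply)
  qed
  then show ?thesis using h(1) by (simp add: affine_map_def)
qed

lemma ext_comp:
  assumes "affine_map f" "bij f" "bij g"
  shows "ext (f \<circ> g) X = ext f (ext g X)"
proof -
  let ?v = "rep_epoint X"
  have nz: "lift g ?v \<noteq> 0" using lift_eq_0_iff[OF assms(3)] rep_epoint_nonzero by blast
  obtain k where k: "k \<noteq> 0" "rep_epoint (abs_epoint (lift g ?v)) = k *\<^sub>R lift g ?v"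
    using rep_abs_epoint[OF nz] .
  have "lift f (lift g ?v) \<noteq> 0" using nz lift_eq_0_iff[OF assms(2)] by blast
  then have "abs_epoint (lift f (lift g ?v)) = abs_epoint (k *\<^sub>R lift f (lift g ?v))"
    using k(1) by (subst abs_epoint_eq_iff) auto
  then show ?thesis
    by (simp add: ext_eq_lift lift_comp[OF assms(1)] k(2) linear_scale[OF linear_lift[OF assms(1)]])
qed

lemma ext_inv_ext:
  assumes "affine_map f" "bij f"
  shows "ext (inv f) (ext f X) = X"
  using ext_comp[OF affine_map_inv[OF assms] bij_imp_bij_inv[OF assms(2)] assms(2), of X] assms(2)
  by (simp add: ext_id bij_is_inj)

lemma ext_ext_inv:
  assumes "affine_map f" "bij f"
  shows "ext f (ext (inv f) X) = X"
  using ext_comp[OF assms bij_imp_bij_inv[OF assms(2)], of X]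
    surj_iff[THEN iffD1, OF bij_is_surj[OF assms(2)]]
  by (simp add: ext_id)

text \<open>
  Images under inverse maps, which occur in the circumconic and in \<open>l\<close>, are preimages: their
  equations arise by substitution.
\<close>

lemma image_ext_inv:
  assumes "affine_map f" "bij f"
  shows "ext (inv f) ` S = {X. ext f X \<in> S}"
proof (intro set_eqI iffI)
  fix X assume "X \<in> {X. ext f X \<in> S}"
  then show "X \<in> ext (inv f) ` S" using ext_inv_ext[OF assms, of X] by (metis imageI mem_Collect_eq)
qed (auto simp: ext_ext_inv[OF assms])

context triangle
begin

lemma lift_hvec:
  assumes "affine_map f"
  shows "lift f (hvec x y z) = x *\<^sub>R hom (f A) + y *\<^sub>R hom (f B) + z *\<^sub>R hom (f C)"
  by (simp add: hvec_def linear_add[OF linear_lift[OF assms]] linear_scale[OF linear_lift[OF assms]] lift_hom)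

lemma ext_pnt:
  assumes "affine_map f" "lift f (hvec x y z) = hvec x' y' z'"
    and "x \<noteq> 0 \<or> y \<noteq> 0 \<or> z \<noteq> 0" "x' \<noteq> 0 \<or> y' \<noteq> 0 \<or> z' \<noteq> 0"
  shows "ext f (pnt x y z) = pnt x' y' z'"
proof -
  obtain k where k: "k \<noteq> 0" "rep_epoint (pnt x y z) = k *\<^sub>R hvec x y z"
    using rep_pnt[OF assms(3)] .
  have "hvec x' y' z' \<noteq> 0" using assms(4) by (auto simp: hvec_eq_0_iff)
  then have "abs_epoint (hvec x' y' z') = abs_epoint (k *\<^sub>R hvec x' y' z')"
    using k(1) by (subst abs_epoint_eq_iff) auto
  then show ?thesis
    unfolding ext_eq_lift k(2) linear_scale[OF linear_lift[OF assms(1)]] assms(2) by (simp add: pnt_eq)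
qed

text \<open>
  With coefficients of sum 1 this is the ordinary point with these coordinates, with coefficients
  of sum 0 a translation vector.
\<close>

definition apt :: "real \<Rightarrow> real \<Rightarrow> real \<Rightarrow> real^2" where
  "apt x y z = x *\<^sub>R A + y *\<^sub>R B + z *\<^sub>R C"

lemma hom_apt: "x + y + z = 1 \<Longrightarrow> hom (apt x y z) = hvec x y z"
  by (simp add: apt_def hom_def hvec_components)

lemma ord_pt_apt: "x + y + z = 1 \<Longrightarrow> ord_pt (apt x y z) = pnt x y z"
  by (simp add: ord_pt_def hom_apt pnt_eq)

lemma apt_cases:
  obtains x y z where "x + y + z = 1" "u = apt x y z"
  using hvec_coordinates[of "hom u"] by (metis apt_def hom_def hvec_components prod.inject)

lemma hom_eq_iff: "hom u = hom v \<longleftrightarrow> u = v"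
  by (simp add: hom_def)

lemma ext_pnt_bij:
  assumes "affine_map f" "bij f" "lift f (hvec x y z) = hvec x' y' z'" "x \<noteq> 0 \<or> y \<noteq> 0 \<or> z \<noteq> 0"
  shows "x' \<noteq> 0 \<or> y' \<noteq> 0 \<or> z' \<noteq> 0" "ext f (pnt x y z) = pnt x' y' z'"
proof -
  show *: "x' \<noteq> 0 \<or> y' \<noteq> 0 \<or> z' \<noteq> 0"
    using lift_eq_0_iff[OF assms(2), of "hvec x y z"] assms(4) unfolding assms(3) hvec_eq_0_iff by blast
  show "ext f (pnt x y z) = pnt x' y' z'" by (rule ext_pnt[OF assms(1,3,4) *])
qed

lemma affine_map_eqI:
  assumes "affine_map f" "affine_map g" "f A = g A" "f B = g B" "f C = g C"
  shows "f = g"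
proof
  fix u
  obtain x y z where "x + y + z = 1" "u = apt x y z" by (rule apt_cases)
  then have "hom (f u) = lift f (hvec x y z)" "hom (g u) = lift g (hvec x y z)"
    by (simp_all add: lift_hom hom_apt[symmetric])
  then have "hom (f u) = hom (g u)" using assms by (simp add: lift_hvec)
  then show "f u = g u" by (simp add: hom_eq_iff)
qed

text \<open>
  Interpolation: send a point to the combination of the prescribed images with its own
  barycentric coordinates as weights.
\<close>

lemma affine_map_exists:
  obtains f where "affine_map f" "f A = D" "f B = E" "f C = F"
proof
  define f where "f = (\<lambda>u. crdA (hom u) *\<^sub>R D + crdB (hom u) *\<^sub>R E + crdC (hom u) *\<^sub>R F)"
  have h: "hom u = (u, 0) + hom 0" for u :: "real^2" by (simp add: hom_def)
  have "f u - f 0 = crdA (u, 0) *\<^sub>R D + crdB (u, 0) *\<^sub>R E + crdC (u, 0) *\<^sub>R F" for u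
    unfolding f_def h[of u] linear_coordinates[THEN linear_add] by (simp add: scaleR_add_left)
  moreover have "(u + v, 0) = (u, 0) + (v, 0::real)" "(k *\<^sub>R u, 0) = k *\<^sub>R (u, 0::real)" for u v :: "real^2" and k
    by simp_all
  ultimately show "affine_map f" unfolding affine_map_def
    by (auto intro!: linearI simp: linear_coordinates[THEN linear_add]
        linear_coordinates[THEN linear_scale] scaleR_add_left scaleR_add_right simp del: add_Pair scaleR_Pair)
  show "f A = D" "f B = E" "f C = F"
    by (simp_all add: f_def vertex_homs coordinates_hvec)
qed

section \<open>Complement, traces and cevian maps\<close>

lemma complement_affine:
  "affine_map (complement A B C)" "bij (complement A B C)"
  "inv (complement A B C) = homothety (centroid A B C) (- 2)"
proof -
  have h: "affine_map (homothety c k)" for c :: "real^2" and k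
  proof -
    have "homothety c k x - homothety c k 0 = k *\<^sub>R x" for x
      by (simp add: homothety_def algebra_simps)
    then show ?thesis unfolding affine_map_def by (simp add: linear_scale_self)
  qed
  show "affine_map (complement A B C)" by (simp add: complement_def h)
  have i: "homothety c (- (1/2)) (homothety c (-2) x) = x" "homothety c (-2) (homothety c (- (1/2)) x) = x"
    for c x :: "real^2" by (simp_all add: homothety_def)
  show "bij (complement A B C)" unfolding complement_def
    by (rule o_bij[of "homothety (centroid A B C) (-2)"]) (auto simp: fun_eq_iff i)
  show "inv (complement A B C) = homothety (centroid A B C) (- 2)" unfolding complement_def
    by (rule inv_equality) (simp_all add: i)
qed

lemma complement_vertices:
  "complement A B C A = apt 0 (1/2) (1/2)"
  "complement A B C B = apt (1/2) 0 (1/2)"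
  "complement A B C C = apt (1/2) (1/2) 0"
  unfolding vec_eq_iff
  by (simp_all add: complement_def homothety_def centroid_def apt_def field_simps)

lemma anticomplement_vertices:
  "inv (complement A B C) A = apt (-1) 1 1"
  "inv (complement A B C) B = apt 1 (-1) 1"
  "inv (complement A B C) C = apt 1 1 (-1)"
  unfolding complement_affine(3) vec_eq_iff
  by (simp_all add: homothety_def centroid_def apt_def field_simps)

lemma lift_complement:
  "lift (complement A B C) (hvec x y z) = hvec ((y + z) / 2) ((z + x) / 2) ((x + y) / 2)"
  by (simp add: lift_hvec[OF complement_affine(1)] complement_vertices hom_apt hvec_scale hvec_add
      add_divide_distrib algebra_simps)

lemma lift_anticomplement:
  "lift (inv (complement A B C)) (hvec x y z) = hvec (y + z - x) (z + x - y) (x + y - z)"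
  by (simp add: lift_hvec[OF affine_map_inv[OF complement_affine(1,2)]] anticomplement_vertices
      hom_apt hvec_scale hvec_add algebra_simps)

lemma pnt_scale:
  assumes "k \<noteq> 0" shows "pnt (k * x) (k * y) (k * z) = pnt x y z"
proof (cases "x = 0 \<and> y = 0 \<and> z = 0")
  case False
  then show ?thesis using assms by (subst pnt_eq_iff) auto
qed auto

lemma ext_complement:
  assumes "x \<noteq> 0 \<or> y \<noteq> 0 \<or> z \<noteq> 0"
  shows "ext (complement A B C) (pnt x y z) = pnt (y + z) (z + x) (x + y)"
proof -
  have "ext (complement A B C) (pnt x y z) = pnt ((y + z) / 2) ((z + x) / 2) ((x + y) / 2)"
    using assms by (intro ext_pnt complement_affine lift_complement) auto
  then show ?thesis using pnt_scale[of "1/2" "y + z" "z + x" "x + y"] by simp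
qed

lemma image_anticomplement_lin:
  "ext (inv (complement A B C)) ` lin p q r = lin (q + r) (r + p) (p + q)"
proof (rule set_eq_by_coordinates)
  fix x y z :: real assume nz: "x \<noteq> 0 \<or> y \<noteq> 0 \<or> z \<noteq> 0"
  then have "y + z \<noteq> 0 \<or> z + x \<noteq> 0 \<or> x + y \<noteq> 0" by auto
  then show "pnt x y z \<in> ext (inv (complement A B C)) ` lin p q r \<longleftrightarrow> pnt x y z \<in> lin (q + r) (r + p) (p + q)"
    using nz by (simp add: image_ext_inv complement_affine(1,2) ext_complement pnt_in_lin_iff algebra_simps)
qed

lemma sides: "join (ord_pt B) (ord_pt C) = lin 1 0 0" "join (ord_pt C) (ord_pt A) = lin 0 1 0"
  "join (ord_pt A) (ord_pt B) = lin 0 0 1"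
  by (simp_all add: ord_pt_vertices join_pnt)

lemma join_vertex:
  "y \<noteq> 0 \<or> z \<noteq> 0 \<Longrightarrow> join (ord_pt A) (pnt x y z) = lin 0 (- z) y"
  "z \<noteq> 0 \<or> x \<noteq> 0 \<Longrightarrow> join (ord_pt B) (pnt x y z) = lin z 0 (- x)"
  "x \<noteq> 0 \<or> y \<noteq> 0 \<Longrightarrow> join (ord_pt C) (pnt x y z) = lin (- y) x 0"
  by (auto simp add: ord_pt_vertices join_pnt)

lemma traces:
  "y \<noteq> 0 \<or> z \<noteq> 0 \<Longrightarrow> trace_on A B C (pnt x y z) = pnt 0 y z"
  "z \<noteq> 0 \<or> x \<noteq> 0 \<Longrightarrow> trace_on B C A (pnt x y z) = pnt x 0 z"
  "x \<noteq> 0 \<or> y \<noteq> 0 \<Longrightarrow> trace_on C A B (pnt x y z) = pnt x y 0"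
  by (auto simp add: trace_on_def sides join_vertex meet_lin)

lemma not_on_sides_iff:
  assumes "x \<noteq> 0 \<or> y \<noteq> 0 \<or> z \<noteq> 0"
  shows "\<not> on_sides A B C (pnt x y z) \<longleftrightarrow> x \<noteq> 0 \<and> y \<noteq> 0 \<and> z \<noteq> 0"
  using assms by (simp add: on_sides_def sides pnt_in_lin_iff)

lemma not_on_anticomplementary_sides_iff:
  assumes "x \<noteq> 0 \<or> y \<noteq> 0 \<or> z \<noteq> 0"
  shows "\<not> on_sides (inv (complement A B C) A) (inv (complement A B C) B) (inv (complement A B C) C) (pnt x y z)
    \<longleftrightarrow> y + z \<noteq> 0 \<and> z + x \<noteq> 0 \<and> x + y \<noteq> 0"
  using assms by (auto simp add: on_sides_def anticomplement_vertices ord_pt_apt join_pnt pnt_in_lin_iff)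

lemma isotomic_pnt:
  assumes "p \<noteq> 0" "q \<noteq> 0" "r \<noteq> 0"
  shows "isotomic A B C (pnt p q r) = pnt (q * r) (r * p) (p * q)"
  unfolding isotomic_def
proof (rule the_equality)
  have "pnt (q * r) (r * p) (p * q) = pnt (1 / p) (1 / q) (1 / r)"
    using assms by (simp add: pnt_eq_iff)
  then show "\<exists>x y z. x \<noteq> 0 \<and> y \<noteq> 0 \<and> z \<noteq> 0 \<and> pnt p q r = pnt x y z \<and>
     pnt (q * r) (r * p) (p * q) = pnt (1 / x) (1 / y) (1 / z)" using assms by blast
  fix R assume "\<exists>x y z. x \<noteq> 0 \<and> y \<noteq> 0 \<and> z \<noteq> 0 \<and> pnt p q r = pnt x y z \<and> R = pnt (1 / x) (1 / y) (1 / z)"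
  then obtain x y z where nz: "x \<noteq> 0" "y \<noteq> 0" "z \<noteq> 0" and eq: "pnt p q r = pnt x y z"
    and R: "R = pnt (1 / x) (1 / y) (1 / z)" by blast
  have "q * z = r * y" "r * x = p * z" "p * y = q * x" using assms nz eq by (auto simp: pnt_eq_iff)
  then show "R = pnt (q * r) (r * p) (p * q)"
    using assms nz by (simp add: R pnt_eq_iff field_simps)
qed

lemma emidpoint_pnt:
  assumes "a \<noteq> 0 \<or> b \<noteq> 0 \<or> c \<noteq> 0" "x \<noteq> 0 \<or> y \<noteq> 0 \<or> z \<noteq> 0"
  shows "emidpoint (pnt a b c) (pnt x y z) =
    pnt ((x + y + z) * a + (a + b + c) * x) ((x + y + z) * b + (a + b + c) * y) ((x + y + z) * c + (a + b + c) * z)"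
proof -
  obtain k where k: "k \<noteq> 0" "rep_epoint (pnt a b c) = k *\<^sub>R hvec a b c" using rep_pnt[OF assms(1)] .
  obtain l where l: "l \<noteq> 0" "rep_epoint (pnt x y z) = l *\<^sub>R hvec x y z" using rep_pnt[OF assms(2)] .
  obtain u v s t where uv: "hvec a b c = (u, s)" "hvec x y z = (v, t)"
    and st: "s = a + b + c" "t = x + y + z"
    by (simp add: hvec_components)
  have "emidpoint (pnt a b c) (pnt x y z) = abs_epoint ((k * l) *\<^sub>R (t *\<^sub>R hvec a b c + s *\<^sub>R hvec x y z))"
    by (simp add: emidpoint_def k(2) l(2) uv scaleR_add_right mult_ac flip: mult_2)
  then show ?thesis using pnt_scale[of "k * l"] k l by (simp add: pnt_eq hvec_scale hvec_add flip: st)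
qed

lemma cevian_map_pnt:
  assumes "p \<noteq> 0" "q \<noteq> 0" "r \<noteq> 0" "q + r \<noteq> 0" "r + p \<noteq> 0" "p + q \<noteq> 0"
  defines "f \<equiv> cevian_map A B C (pnt p q r)"
  shows "affine_map f" "bij f"
    "lift f (hvec x y z) = hvec (p * (y / (r + p) + z / (p + q))) (q * (x / (q + r) + z / (p + q)))
      (r * (x / (q + r) + y / (r + p)))"
proof -
  obtain g where g: "affine_map g" "g A = apt 0 (q / (q + r)) (r / (q + r))"
      "g B = apt (p / (r + p)) 0 (r / (r + p))" "g C = apt (p / (p + q)) (q / (p + q)) 0"
    by (rule affine_map_exists)
  have sums: "0 + q / (q + r) + r / (q + r) = 1" "p / (r + p) + 0 + r / (r + p) = 1"
      "p / (p + q) + q / (p + q) + 0 = 1"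
    using assms by (simp_all add: add_divide_distrib[symmetric] add.commute)
  have tr: "ord_pt (g A) = trace_on A B C (pnt p q r)" "ord_pt (g B) = trace_on B C A (pnt p q r)"
      "ord_pt (g C) = trace_on C A B (pnt p q r)"
    using assms by (auto simp: g traces ord_pt_apt[OF sums(1)] ord_pt_apt[OF sums(2)] ord_pt_apt[OF sums(3)] pnt_eq_iff)
  have inj: "ord_pt u = ord_pt v \<Longrightarrow> u = v" for u v
  proof -
    assume "ord_pt u = ord_pt v"
    then obtain k where "hom v = k *\<^sub>R hom u"
      using abs_epoint_eq_iff[of "hom u" "hom v"] by (auto simp: ord_pt_def hom_def prod_eq_iff)
    then show "u = v" by (simp add: hom_def)
  qed
  have fg: "f = g" unfolding f_def cevian_map_def
  proof (rule the_equality)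
    fix h assume "affine_map h \<and> ord_pt (h A) = trace_on A B C (pnt p q r) \<and>
      ord_pt (h B) = trace_on B C A (pnt p q r) \<and> ord_pt (h C) = trace_on C A B (pnt p q r)"
    then show "h = g" using g(1) tr inj by (intro affine_map_eqI) auto
  qed (use g tr in auto)
  show "affine_map f" using g fg by simp
  have lf: "lift f (hvec x y z) = hvec (p * (y / (r + p) + z / (p + q))) (q * (x / (q + r) + z / (p + q)))
      (r * (x / (q + r) + y / (r + p)))" for x y z
    by (simp add: fg lift_hvec[OF g(1)] g(2-4) hom_apt[OF sums(1)] hom_apt[OF sums(2)] hom_apt[OF sums(3)]
        hvec_scale hvec_add) (simp add: algebra_simps)
  show "lift f (hvec x y z) = hvec (p * (y / (r + p) + z / (p + q))) (q * (x / (q + r) + z / (p + q)))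
      (r * (x / (q + r) + y / (r + p)))" by (rule lf)
  show "bij f"
  proof (rule bij_affine_if_lift_injective[OF \<open>affine_map f\<close>])
    fix v assume "lift f v = 0"
    \<comment> \<open>The vanishing of all pairwise sums of three numbers makes the numbers vanish.\<close>
    then have "lift f (hvec (crdA v) (crdB v) (crdC v)) = 0" by (simp add: hvec_coordinates)
    then have "crdB v / (r + p) + crdC v / (p + q) = 0" "crdA v / (q + r) + crdC v / (p + q) = 0"
        "crdA v / (q + r) + crdB v / (r + p) = 0"
      using assms(1-6) by (auto simp: lf hvec_eq_0_iff)
    then have "crdA v / (q + r) = 0" "crdB v / (r + p) = 0" "crdC v / (p + q) = 0" by linarith+
    then have "hvec (crdA v) (crdB v) (crdC v) = 0" using assms by (simp add: hvec_eq_0_iff)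
    then show "v = 0" by (simp add: hvec_coordinates)
  qed
qed


section \<open>Parallels\<close>

text \<open>
  A common point of two lines and the line at infinity \<open>x + y + z = 0\<close> makes the determinant of the
  three lines vanish.
\<close>

lemma parallel_lin_imp_det:
  assumes "parallel (lin a b c) (lin p q r)"
  shows "a * (q - r) + b * (r - p) + c * (p - q) = 0"
proof -
  obtain X where X: "X \<in> lin a b c" "X \<in> lin p q r" "X \<in> line_at_infinity"
    using assms unfolding parallel_def by blast
  obtain x y z where nz: "x \<noteq> 0 \<or> y \<noteq> 0 \<or> z \<noteq> 0" and "X = pnt x y z" by (rule epoint_cases)
  with X have "a * x + b * y + c * z = 0" "p * x + q * y + r * z = 0" "1 * x + 1 * y + 1 * z = 0"
    by (auto simp: line_at_infinity_eq pnt_in_lin_iff)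
  from orthogonal_to_three_imp_det[OF nz this] show ?thesis by algebra
qed

text \<open>
  The point at infinity of \<open>BC\<close> is \<open>(0 : 1 : -1)\<close>, and the parallel joins it to the given point.
  The hypothesis keeps the point off the line at infinity, where a parallel to \<open>BC\<close> exists only
  through \<open>(0 : 1 : -1)\<close> and is not unique.
\<close>

lemma parallel_through_BC:
  assumes "a + b + c \<noteq> 0"
  shows "parallel_through (pnt a b c) (join (ord_pt B) (ord_pt C)) = lin (- (b + c)) a a"
  unfolding parallel_through_def sides
proof (rule the_equality)
  have nz: "a \<noteq> 0 \<or> b \<noteq> 0 \<or> c \<noteq> 0" and nl: "- (b + c) \<noteq> 0 \<or> a \<noteq> 0 \<or> a \<noteq> 0" using assms by auto
  have "pnt 0 1 (-1) \<in> lin (- (b + c)) a a \<inter> lin 1 0 0 \<inter> line_at_infinity"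
    by (simp add: line_at_infinity_eq pnt_in_lin_iff)
  moreover have "lin (- (b + c)) a a \<noteq> line_at_infinity" "lin 1 0 0 \<noteq> line_at_infinity"
    unfolding line_at_infinity_eq using assms nl by (subst lin_eq_iff; auto)+
  moreover have "is_line (lin (- (b + c)) a a)" "is_line (lin 1 0 0)"
    using nl by (intro is_line_lin; simp)+
  moreover have "pnt a b c \<in> lin (- (b + c)) a a" using nz by (simp add: pnt_in_lin_iff algebra_simps)
  ultimately show "pnt a b c \<in> lin (- (b + c)) a a \<and> parallel (lin (- (b + c)) a a) (lin 1 0 0)"
    unfolding parallel_def by blast
  fix M assume M: "pnt a b c \<in> M \<and> parallel M (lin 1 0 0)"
  then obtain p q r where nm: "p \<noteq> 0 \<or> q \<noteq> 0 \<or> r \<noteq> 0" and Meq: "M = lin p q r"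
    using is_line_cases unfolding parallel_def by metis
  have "q = r" using parallel_lin_imp_det M by (force simp: Meq)
  moreover have "p * a + q * b + r * c = 0" using M nz by (simp add: Meq pnt_in_lin_iff)
  ultimately show "M = lin (- (b + c)) a a"
    unfolding Meq using nm nl by (subst lin_eq_iff) (auto simp: algebra_simps)
qed

section \<open>Conics\<close>

text \<open>
  The coefficients are those of \<open>x\<^sup>2\<close>, \<open>y\<^sup>2\<close>, \<open>z\<^sup>2\<close>, \<open>yz\<close>, \<open>zx\<close>, \<open>xy\<close>, in this order.
\<close>

definition bary_conic :: "real \<Rightarrow> real \<Rightarrow> real \<Rightarrow> real \<Rightarrow> real \<Rightarrow> real \<Rightarrow> epoint set" where
  "bary_conic a b c d e f = {pnt x y z | x y z. (x \<noteq> 0 \<or> y \<noteq> 0 \<or> z \<noteq> 0) \<and>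
     a * x\<^sup>2 + b * y\<^sup>2 + c * z\<^sup>2 + d * (y * z) + e * (z * x) + f * (x * y) = 0}"

lemma pnt_in_bary_conic_iff:
  assumes "x \<noteq> 0 \<or> y \<noteq> 0 \<or> z \<noteq> 0"
  shows "pnt x y z \<in> bary_conic a b c d e f \<longleftrightarrow>
    a * x\<^sup>2 + b * y\<^sup>2 + c * z\<^sup>2 + d * (y * z) + e * (z * x) + f * (x * y) = 0"
proof
  assume "pnt x y z \<in> bary_conic a b c d e f"
  then obtain x' y' z' where nz: "x' \<noteq> 0 \<or> y' \<noteq> 0 \<or> z' \<noteq> 0" and eq: "pnt x y z = pnt x' y' z'"
    and q: "a * x'\<^sup>2 + b * y'\<^sup>2 + c * z'\<^sup>2 + d * (y' * z') + e * (z' * x') + f * (x' * y') = 0"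
    unfolding bary_conic_def by auto
  obtain k where "x = k * x'" "y = k * y'" "z = k * z'"
    using eq pnt_eq_iff[OF nz assms] proportional_iff_cross_zero[OF nz assms] by metis
  then have "a * x\<^sup>2 + b * y\<^sup>2 + c * z\<^sup>2 + d * (y * z) + e * (z * x) + f * (x * y)
    = k\<^sup>2 * (a * x'\<^sup>2 + b * y'\<^sup>2 + c * z'\<^sup>2 + d * (y' * z') + e * (z' * x') + f * (x' * y'))"
    by algebra
  then show "a * x\<^sup>2 + b * y\<^sup>2 + c * z\<^sup>2 + d * (y * z) + e * (z * x) + f * (x * y) = 0"
    using q by simp
qed (use assms in \<open>unfold bary_conic_def, blast\<close>)

lemma bary_conic_scale:
  assumes "k \<noteq> 0"
  shows "bary_conic (k * a) (k * b) (k * c) (k * d) (k * e) (k * f) = bary_conic a b c d e f"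
proof (rule set_eq_by_coordinates)
  fix x y z :: real assume nz: "x \<noteq> 0 \<or> y \<noteq> 0 \<or> z \<noteq> 0"
  have "k * a * x\<^sup>2 + k * b * y\<^sup>2 + k * c * z\<^sup>2 + k * d * (y * z) + k * e * (z * x) + k * f * (x * y)
    = k * (a * x\<^sup>2 + b * y\<^sup>2 + c * z\<^sup>2 + d * (y * z) + e * (z * x) + f * (x * y))" by algebra
  then show "pnt x y z \<in> bary_conic (k * a) (k * b) (k * c) (k * d) (k * e) (k * f)
    \<longleftrightarrow> pnt x y z \<in> bary_conic a b c d e f"
    using assms by (simp add: pnt_in_bary_conic_iff[OF nz])
qed

lemma bilinear_hvec:
  assumes "bilinear b"
  shows "b (hvec x y z) w = x * b (hom A) w + y * b (hom B) w + z * (b (hom C) w :: real)"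
    "b w (hvec x y z) = x * b w (hom A) + y * b w (hom B) + z * b w (hom C)"
  by (simp_all add: hvec_def bilinear_ladd[OF assms] bilinear_radd[OF assms] bilinear_lmul[OF assms]
      bilinear_rmul[OF assms])

lemma bilinear_scale_rep_pnt:
  fixes b :: "(real^2) \<times> real \<Rightarrow> (real^2) \<times> real \<Rightarrow> real"
  assumes "bilinear b" "x \<noteq> 0 \<or> y \<noteq> 0 \<or> z \<noteq> 0"
  obtains k where "k \<noteq> 0" "\<And>w. b (rep_epoint (pnt x y z)) w = k * b (hvec x y z) w"
    "\<And>w. b w (rep_epoint (pnt x y z)) = k * b w (hvec x y z)"
proof -
  obtain k where "k \<noteq> 0" "rep_epoint (pnt x y z) = k *\<^sub>R hvec x y z" using rep_pnt[OF assms(2)] .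
  then show ?thesis using that[of k] bilinear_lmul[OF assms(1)] bilinear_rmul[OF assms(1)] by simp
qed

lemma conic_of_eq_bary_conic:
  assumes "conic_form b"
  shows "conic_of b = bary_conic (b (hom A) (hom A)) (b (hom B) (hom B)) (b (hom C) (hom C))
    (2 * b (hom B) (hom C)) (2 * b (hom C) (hom A)) (2 * b (hom A) (hom B))"
proof (rule set_eq_by_coordinates)
  fix x y z :: real assume nz: "x \<noteq> 0 \<or> y \<noteq> 0 \<or> z \<noteq> 0"
  have bl: "bilinear b" and sym: "b v w = b w v" for v w
    using assms unfolding conic_form_def by blast+
  obtain k where "k \<noteq> 0" "\<And>w. b (rep_epoint (pnt x y z)) w = k * b (hvec x y z) w"
    "\<And>w. b w (rep_epoint (pnt x y z)) = k * b w (hvec x y z)"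
    using bilinear_scale_rep_pnt[OF bl nz] by blast
  then have "pnt x y z \<in> conic_of b \<longleftrightarrow> b (hvec x y z) (hvec x y z) = 0"
    by (simp add: conic_of_def)
  moreover have "b (hvec x y z) (hvec x y z)
    = b (hom A) (hom A) * x\<^sup>2 + b (hom B) (hom B) * y\<^sup>2 + b (hom C) (hom C) * z\<^sup>2
      + 2 * b (hom B) (hom C) * (y * z) + 2 * b (hom C) (hom A) * (z * x) + 2 * b (hom A) (hom B) * (x * y)"
    unfolding bilinear_hvec[OF bl] sym[of "hom C" "hom B"] sym[of "hom A" "hom C"] sym[of "hom B" "hom A"]
    by algebra
  ultimately show "pnt x y z \<in> conic_of b \<longleftrightarrow> pnt x y z \<in> bary_conic (b (hom A) (hom A)) (b (hom B) (hom B))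
    (b (hom C) (hom C)) (2 * b (hom B) (hom C)) (2 * b (hom C) (hom A)) (2 * b (hom A) (hom B))"
    by (simp add: pnt_in_bary_conic_iff[OF nz])
qed

text \<open>
  Nondegeneracy, tested on the three vertices.
\<close>

lemma conic_form_nonzero:
  assumes "conic_form b"
  shows "b (hvec x y z) (hom A) = 0 \<and> b (hvec x y z) (hom B) = 0 \<and> b (hvec x y z) (hom C) = 0
    \<longleftrightarrow> x = 0 \<and> y = 0 \<and> z = 0"
proof
  have bl: "bilinear b" using assms by (simp add: conic_form_def)
  assume z: "b (hvec x y z) (hom A) = 0 \<and> b (hvec x y z) (hom B) = 0 \<and> b (hvec x y z) (hom C) = 0"
  have "b (hvec x y z) w = 0" for w
    using z bilinear_hvec(2)[OF bl, of "hvec x y z" "crdA w" "crdB w" "crdC w"]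
    by (simp add: hvec_coordinates)
  then show "x = 0 \<and> y = 0 \<and> z = 0" using assms hvec_eq_0_iff unfolding conic_form_def by blast
next
  have bl: "bilinear b" using assms by (simp add: conic_form_def)
  assume "x = 0 \<and> y = 0 \<and> z = 0"
  then show "b (hvec x y z) (hom A) = 0 \<and> b (hvec x y z) (hom B) = 0 \<and> b (hvec x y z) (hom C) = 0"
    by (simp add: bilinear_hvec(1)[OF bl])
qed

lemma polar_eq_lin:
  assumes "conic_form b" "x \<noteq> 0 \<or> y \<noteq> 0 \<or> z \<noteq> 0"
  shows "polar b (pnt x y z)
    = lin (b (hvec x y z) (hom A)) (b (hvec x y z) (hom B)) (b (hvec x y z) (hom C))"
proof -
  have bl: "bilinear b" using assms by (simp add: conic_form_def)
  obtain k where k: "k \<noteq> 0" "\<And>w. b (rep_epoint (pnt x y z)) w = k * b (hvec x y z) w"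
    "\<And>w. b w (rep_epoint (pnt x y z)) = k * b w (hvec x y z)"
    by (rule bilinear_scale_rep_pnt[OF bl assms(2)]) (rule that)
  have "linear (b (hvec x y z))" using bl unfolding bilinear_def by blast
  note line = zero_set_of_functional[OF this]
  have "polar b (pnt x y z) = {Y. b (hvec x y z) (rep_epoint Y) = 0}"
    unfolding polar_def k(2) using k(1) by simp
  then show ?thesis unfolding line .
qed

lemma polar_eq_lin_iff:
  assumes "conic_form b" "x \<noteq> 0 \<or> y \<noteq> 0 \<or> z \<noteq> 0" "p \<noteq> 0 \<or> q \<noteq> 0 \<or> r \<noteq> 0"
  defines "u \<equiv> b (hvec x y z)"
  shows "polar b (pnt x y z) = lin p q r
    \<longleftrightarrow> u (hom B) * r = u (hom C) * q \<and> u (hom C) * p = u (hom A) * r \<and> u (hom A) * q = u (hom B) * p"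
proof -
  have "b (hvec x y z) (hom A) \<noteq> 0 \<or> b (hvec x y z) (hom B) \<noteq> 0 \<or> b (hvec x y z) (hom C) \<noteq> 0"
    using conic_form_nonzero[OF assms(1), of x y z] assms(2) by blast
  from lin_eq_iff[OF this assms(3)] show ?thesis unfolding polar_eq_lin[OF assms(1,2)] u_def .
qed

text \<open>
  The hypothesis says that four times the determinant of the symmetric matrix of the form is
  nonzero.
\<close>

lemma conic_form_exists:
  assumes "4 * a * b * c + d * e * f - a * d\<^sup>2 - b * e\<^sup>2 - c * f\<^sup>2 \<noteq> 0"
  obtains \<beta> where "conic_form \<beta>" "\<beta> (hom A) (hom A) = a" "\<beta> (hom B) (hom B) = b" "\<beta> (hom C) (hom C) = c"
    "\<beta> (hom B) (hom C) = d / 2" "\<beta> (hom C) (hom A) = e / 2" "\<beta> (hom A) (hom B) = f / 2"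
    "\<beta> (hom C) (hom B) = d / 2" "\<beta> (hom A) (hom C) = e / 2" "\<beta> (hom B) (hom A) = f / 2"
proof -
  define \<beta> where "\<beta> = (\<lambda>v w. (a * crdA v + f / 2 * crdB v + e / 2 * crdC v) * crdA w
    + (f / 2 * crdA v + b * crdB v + d / 2 * crdC v) * crdB w
    + (e / 2 * crdA v + d / 2 * crdB v + c * crdC v) * crdC w)"
  have vals: "\<beta> (hom A) (hom A) = a" "\<beta> (hom B) (hom B) = b" "\<beta> (hom C) (hom C) = c"
    "\<beta> (hom B) (hom C) = d / 2" "\<beta> (hom C) (hom A) = e / 2" "\<beta> (hom A) (hom B) = f / 2"
    "\<beta> (hom C) (hom B) = d / 2" "\<beta> (hom A) (hom C) = e / 2" "\<beta> (hom B) (hom A) = f / 2"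
    by (simp_all add: \<beta>_def vertex_homs coordinates_hvec)
  have "bilinear \<beta>" unfolding bilinear_def \<beta>_def
    by (intro conjI allI linearI; simp only: linear_coordinates[THEN linear_add]
        linear_coordinates[THEN linear_scale] real_scaleR_def; simp add: algebra_simps add_divide_distrib)
  moreover have "\<beta> v w = \<beta> w v" for v w unfolding \<beta>_def by algebra
  moreover have "v = 0" if "\<forall>w. \<beta> v w = 0" for v
  proof -
    let ?x = "crdA v" and ?y = "crdB v" and ?z = "crdC v"
    have "\<beta> v (hom A) = 0" "\<beta> v (hom B) = 0" "\<beta> v (hom C) = 0" using that by blast+
    then have "(2 * a) * ?x + f * ?y + e * ?z = 0" "f * ?x + (2 * b) * ?y + d * ?z = 0"
      "e * ?x + d * ?y + (2 * c) * ?z = 0"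
      by (simp_all add: \<beta>_def vertex_homs coordinates_hvec algebra_simps)
    note det = orthogonal_to_three_imp_det[OF _ this]
    have "2 * a * (2 * b * (2 * c) - d * d) - f * (f * (2 * c) - d * e) + e * (f * d - 2 * b * e)
        = 2 * (4 * a * b * c + d * e * f - a * d\<^sup>2 - b * e\<^sup>2 - c * f\<^sup>2)" by algebra
    then have "2 * a * (2 * b * (2 * c) - d * d) - f * (f * (2 * c) - d * e) + e * (f * d - 2 * b * e) \<noteq> 0"
      using assms by simp
    then have "?x = 0 \<and> ?y = 0 \<and> ?z = 0" using det by blast
    then have "hvec ?x ?y ?z = 0" by (simp add: hvec_eq_0_iff)
    then show "v = 0" by (simp add: hvec_coordinates)
  qed
  ultimately have "conic_form \<beta>" unfolding conic_form_def by blast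
  from that[OF this vals] show ?thesis .
qed


section \<open>The inconic and the nine-point conic\<close>

lemma isotomcomplement_pnt:
  assumes nz: "p \<noteq> 0" "q \<noteq> 0" "r \<noteq> 0"
  shows "isotomcomplement A B C (pnt p q r) = pnt (p * (q + r)) (q * (r + p)) (r * (p + q))"
    "p * (q + r) \<noteq> 0 \<or> q * (r + p) \<noteq> 0 \<or> r * (p + q) \<noteq> 0"
proof -
  have "isotomcomplement A B C (pnt p q r) = pnt (r * p + p * q) (p * q + q * r) (q * r + r * p)"
    using nz by (simp add: isotomcomplement_def isotomic_pnt ext_complement)
  then show "isotomcomplement A B C (pnt p q r) = pnt (p * (q + r)) (q * (r + p)) (r * (p + q))"
    by (simp add: algebra_simps)
  have "q + r \<noteq> 0 \<or> r + p \<noteq> 0 \<or> p + q \<noteq> 0" using nz by auto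
  then show "p * (q + r) \<noteq> 0 \<or> q * (r + p) \<noteq> 0 \<or> r * (p + q) \<noteq> 0" using nz by auto
qed

text \<open>
  In terms of the reciprocals \<open>u = 1/p\<close>, \<open>v = 1/q\<close>, \<open>w = 1/r\<close> the conic is
  \<open>u\<^sup>2x\<^sup>2 + v\<^sup>2y\<^sup>2 + w\<^sup>2z\<^sup>2 - 2vw yz - 2wu zx - 2uv xy = 0\<close>, multiplied by \<open>(pqr)\<^sup>2\<close>. Tangency at a trace
  gives two linear equations for the coefficients of the form; the six equations of the three
  sides determine the form up to a factor.
\<close>

lemma inconic_eq:
  assumes nz: "p \<noteq> 0" "q \<noteq> 0" "r \<noteq> 0"
  shows "inconic A B C (pnt p q r) = bary_conic ((q * r)\<^sup>2) ((r * p)\<^sup>2) ((p * q)\<^sup>2)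
    (- 2 * p\<^sup>2 * q * r) (- 2 * q\<^sup>2 * r * p) (- 2 * r\<^sup>2 * p * q)"
  unfolding inconic_def
proof (rule the_equality)
  have tr: "trace_on A B C (pnt p q r) = pnt 0 q r" "trace_on B C A (pnt p q r) = pnt p 0 r"
    "trace_on C A B (pnt p q r) = pnt p q 0" using nz by (simp_all add: traces)
  have "4 * (q * r)\<^sup>2 * (r * p)\<^sup>2 * (p * q)\<^sup>2
      + (- 2 * p\<^sup>2 * q * r) * (- 2 * q\<^sup>2 * r * p) * (- 2 * r\<^sup>2 * p * q)
      - (q * r)\<^sup>2 * (- 2 * p\<^sup>2 * q * r)\<^sup>2 - (r * p)\<^sup>2 * (- 2 * q\<^sup>2 * r * p)\<^sup>2 - (p * q)\<^sup>2 * (- 2 * r\<^sup>2 * p * q)\<^sup>2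
    = - 16 * (p * q * r)^4" by algebra
  also have "\<dots> \<noteq> 0" using nz by simp
  finally obtain b where b: "conic_form b" "b (hom A) (hom A) = (q * r)\<^sup>2" "b (hom B) (hom B) = (r * p)\<^sup>2"
      "b (hom C) (hom C) = (p * q)\<^sup>2" "b (hom B) (hom C) = (- 2 * p\<^sup>2 * q * r) / 2"
      "b (hom C) (hom A) = (- 2 * q\<^sup>2 * r * p) / 2" "b (hom A) (hom B) = (- 2 * r\<^sup>2 * p * q) / 2"
      "b (hom C) (hom B) = (- 2 * p\<^sup>2 * q * r) / 2"
      "b (hom A) (hom C) = (- 2 * q\<^sup>2 * r * p) / 2" "b (hom B) (hom A) = (- 2 * r\<^sup>2 * p * q) / 2"
    by (rule conic_form_exists)
  have bl: "bilinear b" using b(1) by (simp add: conic_form_def)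
  have cb: "conic_of b = bary_conic ((q * r)\<^sup>2) ((r * p)\<^sup>2) ((p * q)\<^sup>2)
    (- 2 * p\<^sup>2 * q * r) (- 2 * q\<^sup>2 * r * p) (- 2 * r\<^sup>2 * p * q)"
    unfolding conic_of_eq_bary_conic[OF b(1)] b(2-7) by (simp add: mult.assoc)
  have bh: "b (hvec x y z) (hom A) = q * r * (q * r * x - r * p * y - p * q * z) "
    "b (hvec x y z) (hom B) = r * p * (r * p * y - q * r * x - p * q * z)"
    "b (hvec x y z) (hom C) = p * q * (p * q * z - q * r * x - r * p * y)" for x y z
    unfolding bilinear_hvec[OF bl] b(2-) by algebra+
  have Q: "isotomcomplement A B C (pnt p q r) = pnt (p * (q + r)) (q * (r + p)) (r * (p + q))"
    and Qnz: "p * (q + r) \<noteq> 0 \<or> q * (r + p) \<noteq> 0 \<or> r * (p + q) \<noteq> 0"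
    using isotomcomplement_pnt[OF nz] by auto
  have "conic_center b (isotomcomplement A B C (pnt p q r))"
    unfolding conic_center_def line_at_infinity_eq Q
    by (subst polar_eq_lin_iff[OF b(1) Qnz]) (auto simp: bh algebra_simps)
  moreover have "conic_tangent_at b (lin 1 0 0) (pnt 0 q r)" "conic_tangent_at b (lin 0 1 0) (pnt p 0 r)"
      "conic_tangent_at b (lin 0 0 1) (pnt p q 0)"
    unfolding conic_tangent_at_def using nz
    by (simp_all add: polar_eq_lin_iff[OF b(1)] cb pnt_in_bary_conic_iff bh power2_eq_square)
  ultimately show "\<exists>b. conic_form b \<and> bary_conic ((q * r)\<^sup>2) ((r * p)\<^sup>2) ((p * q)\<^sup>2)
      (- 2 * p\<^sup>2 * q * r) (- 2 * q\<^sup>2 * r * p) (- 2 * r\<^sup>2 * p * q) = conic_of b \<and>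
     conic_center b (isotomcomplement A B C (pnt p q r)) \<and>
     conic_tangent_at b (join (ord_pt B) (ord_pt C)) (trace_on A B C (pnt p q r)) \<and>
     conic_tangent_at b (join (ord_pt C) (ord_pt A)) (trace_on B C A (pnt p q r)) \<and>
     conic_tangent_at b (join (ord_pt A) (ord_pt B)) (trace_on C A B (pnt p q r))"
    using b(1) cb unfolding sides tr by metis
  fix I assume "\<exists>b. conic_form b \<and> I = conic_of b \<and>
     conic_center b (isotomcomplement A B C (pnt p q r)) \<and>
     conic_tangent_at b (join (ord_pt B) (ord_pt C)) (trace_on A B C (pnt p q r)) \<and>
     conic_tangent_at b (join (ord_pt C) (ord_pt A)) (trace_on B C A (pnt p q r)) \<and>
     conic_tangent_at b (join (ord_pt A) (ord_pt B)) (trace_on C A B (pnt p q r))"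
  then obtain b where b: "conic_form b" and I: "I = conic_of b"
    and t: "polar b (pnt 0 q r) = lin 1 0 0" "polar b (pnt p 0 r) = lin 0 1 0" "polar b (pnt p q 0) = lin 0 0 1"
    unfolding sides tr conic_tangent_at_def by blast
  have bl: "bilinear b" and sym: "b v w = b w v" for v w
    using b unfolding conic_form_def by blast+
  let ?a = "b (hom A) (hom A)" and ?b = "b (hom B) (hom B)" and ?c = "b (hom C) (hom C)"
  let ?d = "b (hom B) (hom C)" and ?e = "b (hom C) (hom A)" and ?f = "b (hom A) (hom B)"
  have *: "q * ?b + r * ?d = 0" "q * ?d + r * ?c = 0" "p * ?a + r * ?e = 0" "p * ?e + r * ?c = 0"
      "p * ?a + q * ?f = 0" "p * ?f + q * ?b = 0"
    using t nz by (simp_all add: polar_eq_lin_iff[OF b] bilinear_hvec[OF bl] sym[of "hom C" "hom B"]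
        sym[of "hom A" "hom C"] sym[of "hom B" "hom A"])
  \<comment> \<open>The form turns out to be the claimed one multiplied by \<open>k\<close>.\<close>
  define k where "k = ?a / (q * r)\<^sup>2"
  have a: "?a = k * (q * r)\<^sup>2" using nz by (simp add: k_def)
  have "q * (?f + k * p * q * r\<^sup>2) = 0" "r * (?e + k * p * q\<^sup>2 * r) = 0" using * a by algebra+
  then have fe: "?f = - (k * p * q * r\<^sup>2)" "?e = - (k * p * q\<^sup>2 * r)" using nz by auto
  have "q * (?b - k * (r * p)\<^sup>2) = 0" "r * (?c - k * (p * q)\<^sup>2) = 0" using * fe by algebra+
  then have bc: "?b = k * (r * p)\<^sup>2" "?c = k * (p * q)\<^sup>2" using nz by auto
  have "r * (?d + k * p\<^sup>2 * q * r) = 0" using *(1) bc by algebra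
  then have d: "?d = - (k * p\<^sup>2 * q * r)" using nz by auto
  have "k \<noteq> 0"
  proof
    assume "k = 0"
    then show False using conic_form_nonzero[OF b, of 1 0 0] a fe bc d sym[of "hom A" "hom C"]
      by (simp add: bilinear_hvec[OF bl])
  qed
  have "I = bary_conic (k * (q * r)\<^sup>2) (k * (r * p)\<^sup>2) (k * (p * q)\<^sup>2)
      (k * (- 2 * p\<^sup>2 * q * r)) (k * (- 2 * q\<^sup>2 * r * p)) (k * (- 2 * r\<^sup>2 * p * q))"
    unfolding I conic_of_eq_bary_conic[OF b] a fe bc d by (simp add: mult_ac)
  then show "I = bary_conic ((q * r)\<^sup>2) ((r * p)\<^sup>2) ((p * q)\<^sup>2)
    (- 2 * p\<^sup>2 * q * r) (- 2 * q\<^sup>2 * r * p) (- 2 * r\<^sup>2 * p * q)"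
    unfolding bary_conic_scale[OF \<open>k \<noteq> 0\<close>] .
qed


text \<open>
  The midpoints of \<open>BC\<close>, \<open>CA\<close>, \<open>AB\<close> express the mixed coefficients of a form through the pure ones.
  Each diagonal point on a side then yields an equation that splits into a nonzero factor and the
  proportionality of two pure coefficients to two of \<open>p\<close>, \<open>q\<close>, \<open>r\<close>. The nonzero factor is where
  \<open>q \<noteq> r\<close> and \<open>r \<noteq> p\<close> enter: for \<open>q = r\<close> the diagonal point on \<open>BC\<close> is the midpoint of \<open>BC\<close>.
\<close>

lemma nine_point_conic_eq:
  assumes nz: "p \<noteq> 0" "q \<noteq> 0" "r \<noteq> 0" and sums: "q + r \<noteq> 0" "r + p \<noteq> 0" "p + q \<noteq> 0"
    and distinct: "q \<noteq> r" "r \<noteq> p"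
  shows "nine_point_conic (ord_pt A) (ord_pt B) (ord_pt C) (pnt (q * r) (r * p) (p * q))
    = bary_conic p q r (- (q + r)) (- (r + p)) (- (p + q))"
proof -
  let ?u = "q * r" and ?v = "r * p" and ?w = "p * q"
  have uvw: "?u \<noteq> 0" "?v \<noteq> 0" "?w \<noteq> 0" using nz by auto
  have mids: "emidpoint (ord_pt A) (ord_pt B) = pnt 1 1 0" "emidpoint (ord_pt A) (ord_pt C) = pnt 1 0 1"
    "emidpoint (ord_pt B) (ord_pt C) = pnt 0 1 1"
    "emidpoint (ord_pt A) (pnt ?u ?v ?w) = pnt (?u + ?v + ?w + ?u) ?v ?w"
    "emidpoint (ord_pt B) (pnt ?u ?v ?w) = pnt ?u (?u + ?v + ?w + ?v) ?w"
    "emidpoint (ord_pt C) (pnt ?u ?v ?w) = pnt ?u ?v (?u + ?v + ?w + ?w)"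
    using nz by (simp_all add: ord_pt_vertices emidpoint_pnt)
  have "join (ord_pt A) (ord_pt C) = lin 0 (-1) 0" by (simp add: ord_pt_vertices join_pnt)
  then have diag: "meet (join (ord_pt A) (ord_pt B)) (join (ord_pt C) (pnt ?u ?v ?w)) = pnt ?u ?v 0"
    "meet (join (ord_pt A) (ord_pt C)) (join (ord_pt B) (pnt ?u ?v ?w)) = pnt ?u 0 ?w"
    "meet (join (ord_pt A) (pnt ?u ?v ?w)) (join (ord_pt B) (ord_pt C)) = pnt 0 ?v ?w"
    using uvw by (auto simp add: sides join_vertex meet_lin pnt_eq_iff)
  let ?N = "bary_conic p q r (- (q + r)) (- (r + p)) (- (p + q))"
  have "4 * p * q * r + (- (q + r)) * (- (r + p)) * (- (p + q))
      - p * (- (q + r))\<^sup>2 - q * (- (r + p))\<^sup>2 - r * (- (p + q))\<^sup>2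
    = - 2 * ((q + r) * (r + p) * (p + q))" by algebra
  also have "\<dots> \<noteq> 0" using sums by simp
  finally obtain b where b: "conic_form b" "b (hom A) (hom A) = p" "b (hom B) (hom B) = q"
      "b (hom C) (hom C) = r" "b (hom B) (hom C) = - (q + r) / 2"
      "b (hom C) (hom A) = - (r + p) / 2" "b (hom A) (hom B) = - (p + q) / 2"
    by (rule conic_form_exists)
  have form: "\<exists>b. conic_form b \<and> ?N = conic_of b"
  proof -
    have "2 * (x / 2) = x" for x :: real by simp
    then have "conic_of b = ?N" unfolding conic_of_eq_bary_conic[OF b(1)] b(2-7) by (simp only:)
    then show ?thesis using b(1) by metis
  qed
  have on: "pnt 1 1 0 \<in> ?N" "pnt 1 0 1 \<in> ?N" "pnt 0 1 1 \<in> ?N" "pnt ?u ?v 0 \<in> ?N" "pnt ?u 0 ?w \<in> ?N" "pnt 0 ?v ?w \<in> ?N"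
    "pnt (?u + ?v + ?w + ?u) ?v ?w \<in> ?N" "pnt ?u (?u + ?v + ?w + ?v) ?w \<in> ?N" "pnt ?u ?v (?u + ?v + ?w + ?w) \<in> ?N"
    using nz by (simp_all add: pnt_in_bary_conic_iff) algebra+
  show ?thesis
    unfolding nine_point_conic_def mids diag
  proof (rule the_equality)
    show "(\<exists>b. conic_form b \<and> ?N = conic_of b) \<and>
      {pnt 1 1 0, pnt 1 0 1, pnt (?u + ?v + ?w + ?u) ?v ?w, pnt 0 1 1, pnt ?u (?u + ?v + ?w + ?v) ?w,
       pnt ?u ?v (?u + ?v + ?w + ?w), pnt ?u ?v 0, pnt ?u 0 ?w, pnt 0 ?v ?w} \<subseteq> ?N"
      using form on by blast
    fix N assume "(\<exists>b. conic_form b \<and> N = conic_of b) \<and>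
      {pnt 1 1 0, pnt 1 0 1, pnt (?u + ?v + ?w + ?u) ?v ?w, pnt 0 1 1, pnt ?u (?u + ?v + ?w + ?v) ?w,
       pnt ?u ?v (?u + ?v + ?w + ?w), pnt ?u ?v 0, pnt ?u 0 ?w, pnt 0 ?v ?w} \<subseteq> N"
    then obtain b where b: "conic_form b" and N: "N = conic_of b"
      and mem: "pnt 1 1 0 \<in> N" "pnt 1 0 1 \<in> N" "pnt 0 1 1 \<in> N" "pnt ?u 0 ?w \<in> N" "pnt 0 ?v ?w \<in> N"
      by blast
    let ?a = "b (hom A) (hom A)" and ?b = "b (hom B) (hom B)" and ?c = "b (hom C) (hom C)"
    let ?d = "2 * b (hom B) (hom C)" and ?e = "2 * b (hom C) (hom A)" and ?f = "2 * b (hom A) (hom B)"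
    have Nb: "N = bary_conic ?a ?b ?c ?d ?e ?f" unfolding N by (rule conic_of_eq_bary_conic[OF b])
    have def: "?d = - (?b + ?c)" "?e = - (?c + ?a)" "?f = - (?a + ?b)"
      using mem(1-3) by (simp_all add: Nb pnt_in_bary_conic_iff)
    have "?a * ?u\<^sup>2 + ?c * ?w\<^sup>2 + ?e * (?w * ?u) = 0" "?b * ?v\<^sup>2 + ?c * ?w\<^sup>2 + ?d * (?v * ?w) = 0"
      using mem(4,5) uvw by (simp_all add: Nb pnt_in_bary_conic_iff)
    then have "q\<^sup>2 * ((r - p) * (r * ?a - p * ?c)) = 0" "p\<^sup>2 * ((r - q) * (r * ?b - q * ?c)) = 0"
      unfolding def by algebra+
    then have eqs: "r * ?a = p * ?c" "r * ?b = q * ?c" using nz distinct by auto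
    define k where "k = ?c / r"
    have abc: "?a = k * p" "?b = k * q" "?c = k * r"
      using eqs nz unfolding k_def by (simp_all add: field_simps)
    have "k \<noteq> 0"
    proof
      assume "k = 0"
      have bl: "bilinear b" and sym: "b v w = b w v" for v w
        using b unfolding conic_form_def by blast+
      have "?a = 0" "b (hom A) (hom B) = 0" "b (hom C) (hom A) = 0" using def abc \<open>k = 0\<close> by auto
      then show False using conic_form_nonzero[OF b, of 1 0 0] sym[of "hom A" "hom C"]
        by (simp add: bilinear_hvec(1)[OF bl])
    qed
    have "N = bary_conic (k * p) (k * q) (k * r) (k * (- (q + r))) (k * (- (r + p))) (k * (- (p + q)))"
      unfolding Nb def unfolding abc by (simp add: algebra_simps)
    then show "N = ?N" unfolding bary_conic_scale[OF \<open>k \<noteq> 0\<close>] .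
  qed
qed

section \<open>Isotomic lines and translations\<close>

text \<open>
  The definition quantifies over all equations of the line; these are proportional and give the
  same circumconic.
\<close>

lemma isotomic_line_lin:
  assumes "p \<noteq> 0 \<or> q \<noteq> 0 \<or> r \<noteq> 0"
  shows "isotomic_line A B C (lin p q r) = bary_conic 0 0 0 p q r"
proof -
  have *: "(\<exists>p' q' r'. (p', q', r') \<noteq> (0, 0, 0) \<and> lin p q r = lin p' q' r' \<and>
      p' * y * z + q' * z * x + r' * x * y = 0) \<longleftrightarrow> p * (y * z) + q * (z * x) + r * (x * y) = 0" 
    (is "?L \<longleftrightarrow> ?R") for x y z
  proof
    assume ?L
    then obtain p' q' r' where nz: "p' \<noteq> 0 \<or> q' \<noteq> 0 \<or> r' \<noteq> 0" and eq: "lin p q r = lin p' q' r'"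
      and s: "p' * y * z + q' * z * x + r' * x * y = 0" by auto
    obtain k where k: "p = k * p'" "q = k * q'" "r = k * r'"
      using eq lin_eq_iff[OF nz assms] proportional_iff_cross_zero[OF nz assms] by metis
    have "p * (y * z) + q * (z * x) + r * (x * y) = k * (p' * y * z + q' * z * x + r' * x * y)"
      unfolding k by algebra
    then show ?R using s by simp
  next
    assume ?R
    then show ?L using assms by (intro exI[of _ p] exI[of _ q] exI[of _ r]) (simp add: mult.assoc)
  qed
  show ?thesis unfolding isotomic_line_def bary_conic_def * by simp
qed

text \<open>
  On ordinary points, with coordinates of sum 1, such a map adds constants to the coordinates.
  As the image has again sum 1, the constants have sum 0 and describe a vector.
\<close>

lemma translation_if_lift:
  assumes "affine_map f"
    and "\<And>x y z. lift f (hvec x y z) = hvec (x + a * (x + y + z)) (y + b * (x + y + z)) (z + c * (x + y + z))"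
  shows "is_translation f"
  unfolding is_translation_def
proof (intro exI allI)
  fix u
  obtain x y z where s: "x + y + z = 1" and u: "u = apt x y z" by (rule apt_cases)
  have "hom (f u) = hvec (x + a) (y + b) (z + c)"
    using assms(2)[of x y z] s by (simp add: u hom_apt flip: lift_hom)
  then have "f u = apt (x + a) (y + b) (z + c)" by (simp add: hom_def hvec_components apt_def)
  then show "f u = u + apt a b c" by (simp add: u apt_def algebra_simps)
qed

section \<open>Determination of the point\<close>

text \<open>
  This is where the geometric hypotheses are used up: they leave one parameter, a square root of 2.
\<close>

lemma point_determined:
  assumes "\<not> on_sides A B C P"
    and "\<not> on_sides (inv (complement A B C) A) (inv (complement A B C) B) (inv (complement A B C) C) P"
    and "generalized_orthocenter A B C P (ord_pt A)"
    and "trace_on A B C (isotomic A B C P) = emidpoint (ord_pt A) (isotomic A B C P)"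
  obtains t :: real where "t * t = 2" "P = pnt 1 (1 - t) (1 + t)"
proof -
  obtain p q r where pqr: "p \<noteq> 0 \<or> q \<noteq> 0 \<or> r \<noteq> 0" and P: "P = pnt p q r" by (rule epoint_cases)
  have nz: "p \<noteq> 0" "q \<noteq> 0" "r \<noteq> 0" and sums: "q + r \<noteq> 0" "r + p \<noteq> 0" "p + q \<noteq> 0"
    using assms(1,2) by (simp_all add: P not_on_sides_iff[OF pqr] not_on_anticomplementary_sides_iff[OF pqr])
  have "pnt 0 (r * p) (p * q) = pnt (q * r + r * p + p * q + q * r) (r * p) (p * q)"
    using assms(4) nz by (simp add: P isotomic_pnt traces ord_pt_vertices emidpoint_pnt)
  then have mid: "2 * (q * r) + r * p + p * q = 0" using nz by (simp add: pnt_eq_iff)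
  have "join (isotomcomplement A B C P) (trace_on B C A P)
      = lin (q * (r + p) * r) (r * (p + q) * p - p * (q + r) * r) (- (q * (r + p) * p))"
    using nz sums by (simp add: P isotomcomplement_pnt traces join_pnt)
  moreover have "ord_pt A \<noteq> ord_pt B" by (simp add: ord_pt_vertices pnt_eq_iff)
  then have "parallel (join (ord_pt A) (ord_pt B)) (join (isotomcomplement A B C P) (trace_on B C A P))"
    using assms(3) by (simp add: generalized_orthocenter_def Let_def)
  ultimately have "q * (r + p) * r - (r * (p + q) * p - p * (q + r) * r) = 0"
    using parallel_lin_imp_det by (force simp: sides)
  then have "r * (q * (r + p) - p * (p - r)) = 0" by algebra
  then have par: "q * (r + p) = p * (p - r)" using nz by simp
  \<comment> \<open>Eliminating \<open>q r\<close> from the two conditions leaves a multiple of \<open>p\<close>.\<close>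
  have "p * (q + r - 2 * p) = 0" using mid par by algebra
  then have sum: "q + r = 2 * p" using nz by simp
  then have prod: "q * r = - (p * p)" using mid by algebra
  \<comment> \<open>\<open>q\<close> and \<open>r\<close> have mean \<open>p\<close> and differ from it by \<open>p t\<close>.\<close>
  define t where "t = (r - q) / (2 * p)"
  have "(r - q) * (r - q) = 2 * ((2 * p) * (2 * p))" using sum prod by algebra
  then have "t * t = 2" using nz by (simp add: t_def field_simps)
  moreover have "p * t = (r - q) / 2" using nz by (simp add: t_def)
  then have "q = p * (1 - t)" "r = p * (1 + t)"
    using sum unfolding right_diff_distrib distrib_left by simp_all
  then have "P = pnt 1 (1 - t) (1 + t)" using pnt_scale[of p 1 "1 - t" "1 + t"] nz by (simp add: P)
  ultimately show ?thesis by (rule that)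
qed

end

section \<open>The configuration in coordinates\<close>

text \<open>
  The parameter \<open>t\<close> stands for either square root of 2; the two choices give the two possible
  positions of \<open>P\<close>, which are exchanged by swapping \<open>B\<close> and \<open>C\<close>.
\<close>

locale special_triangle = triangle +
  fixes t :: real
  assumes t2: "t * t = 2"
begin

text \<open>
  With \<open>t2\<close> this reduces every polynomial in \<open>t\<close> to degree at most 1 once products are sorted.
\<close>

lemma t2': "t * (t * x) = 2 * x"
  using t2 by (simp flip: mult.assoc)

lemma conjugate_product: "(1 - t) * (1 + t) = - 1"
  by (simp add: algebra_simps t2)

lemma t_nonzero: "t \<noteq> 0" "1 - t \<noteq> 0" "1 + t \<noteq> 0" "2 - t \<noteq> 0" "2 + t \<noteq> 0"
proof -
  have "t \<noteq> 0" "t \<noteq> 1" "t \<noteq> -1" "t \<noteq> 2" "t \<noteq> -2" using t2 by auto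
  then show "t \<noteq> 0" "1 - t \<noteq> 0" "1 + t \<noteq> 0" "2 - t \<noteq> 0" "2 + t \<noteq> 0" by auto
qed

abbreviation "P \<equiv> pnt 1 (1 - t) (1 + t)"
abbreviation "P' \<equiv> pnt (- 1) (1 + t) (1 - t)"

lemma isotomic_P: "isotomic A B C P = P'"
proof -
  show ?thesis using t_nonzero conjugate_product by (simp add: isotomic_pnt)
qed

abbreviation "T \<equiv> cevian_map A B C P"
abbreviation "T' \<equiv> cevian_map A B C P'"

lemma reciprocals: "x / t = x * t / 2" "x / (2 + t) = x * (2 - t) / 2" "x / (2 - t) = x * (2 + t) / 2"
  using t_nonzero t2 by (simp_all add: field_simps)

lemma T_map: "affine_map T" "bij T"
  "lift T (hvec x y z) = hvec ((y * (2 - t) + z * (2 + t)) / 2) ((1 - t) * (x + z * (2 + t)) / 2)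
     ((1 + t) * (x + y * (2 - t)) / 2)"
proof -
  have s: "1 - t + (1 + t) = 2" "1 + t + 1 = 2 + t" "1 + (1 - t) = 2 - t" by simp_all
  have nz: "(1::real) \<noteq> 0" "1 - t \<noteq> 0" "1 + t \<noteq> 0" "1 - t + (1 + t) \<noteq> 0" "1 + t + 1 \<noteq> 0" "1 + (1 - t) \<noteq> 0"
    unfolding s using t_nonzero by simp_all
  show "affine_map T" "bij T" by (rule cevian_map_pnt[OF nz])+
  show "lift T (hvec x y z) = hvec ((y * (2 - t) + z * (2 + t)) / 2) ((1 - t) * (x + z * (2 + t)) / 2)
     ((1 + t) * (x + y * (2 - t)) / 2)"
    unfolding cevian_map_pnt(3)[OF nz] s reciprocals hvec_eq_iff by (intro conjI; simp add: field_simps)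
qed

lemma T'_map: "affine_map T'" "bij T'"
  "lift T' (hvec x y z) = hvec ((y - z) * t / 2) ((1 + t) * (x + t * z) / 2) ((1 - t) * (x - t * y) / 2)"
proof -
  have s: "1 + t + (1 - t) = 2" "1 - t + - 1 = - t" "- 1 + (1 + t) = t" by simp_all
  have nz: "- (1::real) \<noteq> 0" "1 + t \<noteq> 0" "1 - t \<noteq> 0" "1 + t + (1 - t) \<noteq> 0" "1 - t + - 1 \<noteq> 0" "- 1 + (1 + t) \<noteq> 0"
    unfolding s using t_nonzero by simp_all
  show "affine_map T'" "bij T'" by (rule cevian_map_pnt[OF nz])+
  show "lift T' (hvec x y z) = hvec ((y - z) * t / 2) ((1 + t) * (x + t * z) / 2) ((1 - t) * (x - t * y) / 2)"
    unfolding cevian_map_pnt(3)[OF nz] s divide_minus_right reciprocals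
    by (simp add: add_divide_distrib diff_divide_distrib algebra_simps)
qed

text \<open>
  Substituting \<open>T'\<close> in the form of the nine-point conic gives the form \<open>2yz + zx + xy\<close> multiplied by
  \<open>-1\<close>.
\<close>

lemma circumconic_eq:
  "ext (inv T') ` nine_point_conic (ord_pt A) (ord_pt B) (ord_pt C) P' = bary_conic 0 0 0 2 1 1"
proof -
  have N: "nine_point_conic (ord_pt A) (ord_pt B) (ord_pt C) P'
      = bary_conic 1 (1 - t) (1 + t) (- 2) (- (2 + t)) (- (2 - t))"
  proof -
    have *: "1 - t + (1 + t) = 2" "1 + t + 1 = 2 + t" "1 + (1 - t) = 2 - t" "(1 + t) * 1 = 1 + t" "1 * (1 - t) = 1 - t"
      by simp_all
    show ?thesis using nine_point_conic_eq[of 1 "1 - t" "1 + t"] t_nonzero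
      unfolding * conjugate_product by simp
  qed
  show ?thesis
  proof (rule set_eq_by_coordinates)
    fix x y z :: real assume nz: "x \<noteq> 0 \<or> y \<noteq> 0 \<or> z \<noteq> 0"
    let ?x = "(y - z) * t / 2" and ?y = "(1 + t) * (x + t * z) / 2" and ?z = "(1 - t) * (x - t * y) / 2"
    have "4 * (1 * ?x\<^sup>2 + (1 - t) * ?y\<^sup>2 + (1 + t) * ?z\<^sup>2 + (- 2) * (?y * ?z) + (- (2 + t)) * (?z * ?x)
        + (- (2 - t)) * (?x * ?y)) = 
      ((y - z) * t)\<^sup>2 + (1 - t) * ((1 + t) * (x + t * z))\<^sup>2 + (1 + t) * ((1 - t) * (x - t * y))\<^sup>2
      - 2 * ((1 + t) * (x + t * z)) * ((1 - t) * (x - t * y))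
      - (2 + t) * ((1 - t) * (x - t * y)) * ((y - z) * t) - (2 - t) * ((y - z) * t) * ((1 + t) * (x + t * z))"
      by (simp add: power2_eq_square field_simps)
    also have "\<dots> = - 4 * (0 * x\<^sup>2 + 0 * y\<^sup>2 + 0 * z\<^sup>2 + 2 * (y * z) + 1 * (z * x) + 1 * (x * y))"
      by (simp add: power2_eq_square algebra_simps t2 t2')
    finally show "pnt x y z \<in> ext (inv T') ` nine_point_conic (ord_pt A) (ord_pt B) (ord_pt C) P'
      \<longleftrightarrow> pnt x y z \<in> bary_conic 0 0 0 2 1 1"
      unfolding N image_ext_inv[OF T'_map(1,2)] mem_Collect_eq ext_pnt_bij(2)[OF T'_map nz]
        pnt_in_bary_conic_iff[OF nz] pnt_in_bary_conic_iff[OF ext_pnt_bij(1)[OF T'_map nz]] by auto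
  qed
qed

abbreviation "M \<equiv> T \<circ> inv (complement A B C) \<circ> T'"

text \<open>
  Adding multiples of \<open>x + y + z\<close> to the coordinates is what a translation does to homogeneous
  coordinates. The added vector takes \<open>O = (0, 1/2, 1/2)\<close> to \<open>Q = (1, -t/2, t/2)\<close>, the center of the
  inconic.
\<close>

lemma M_map: "affine_map M" "bij M"
  "lift M (hvec x y z) = hvec (x + 1 * (x + y + z)) (y + (- (1 + t) / 2) * (x + y + z)) (z + (- (1 - t) / 2) * (x + y + z))"
proof -
  note K = affine_map_inv[OF complement_affine(1,2)] bij_imp_bij_inv[OF complement_affine(2)]
  show "affine_map M" by (intro affine_map_comp T_map T'_map K)
  show "bij M" by (intro bij_comp T_map T'_map K)
  show "lift M (hvec x y z) = hvec (x + 1 * (x + y + z)) (y + (- (1 + t) / 2) * (x + y + z)) (z + (- (1 - t) / 2) * (x + y + z))"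
    unfolding lift_comp[OF affine_map_comp[OF T_map(1) K(1)]] lift_comp[OF T_map(1)]
      T_map(3) T'_map(3) lift_anticomplement hvec_eq_iff
    by (intro conjI; simp add: add_divide_distrib diff_divide_distrib algebra_simps t2 t2')
qed

lemma M_translation: "is_translation M"
  by (rule translation_if_lift[OF M_map(1) M_map(3)])

lemma inconic_P:
  "inconic A B C P = bary_conic 1 ((1 + t)\<^sup>2) ((1 - t)\<^sup>2) 2 (2 * (1 - t)) (2 * (1 + t))"
proof -
  have "((1 - t) * (1 + t))\<^sup>2 = 1" "((1 + t) * 1)\<^sup>2 = (1 + t)\<^sup>2" "(1 * (1 - t))\<^sup>2 = (1 - t)\<^sup>2"
    "- 2 * 1\<^sup>2 * (1 - t) * (1 + t) = 2" "- 2 * (1 - t)\<^sup>2 * (1 + t) * 1 = 2 * (1 - t)"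
    "- 2 * (1 + t)\<^sup>2 * 1 * (1 - t) = 2 * (1 + t)"
    by (simp_all add: power2_eq_square algebra_simps t2 t2')
  then show ?thesis using inconic_eq[of 1 "1 - t" "1 + t"] t_nonzero by simp
qed

text \<open>
  This is used with \<open>a = 1 + t\<close>, \<open>b = 1 - t\<close>, \<open>s = x + y + z\<close>. The left-hand side is the inconic at the
  translated point and equals \<open>-2\<close> times the right-hand form. Eliminating \<open>b\<close> and \<open>x\<close> and reducing
  powers of \<open>a\<close> by its quadratic equation keeps the expansion small.
\<close>

lemma translated_conic_identity:
  fixes a b s x y z :: real
  assumes a: "a * a = 1 + 2 * a" and b: "b = 2 - a" and s: "x = s - y - z"
  shows "1 * (x + 1 * s)\<^sup>2 + a\<^sup>2 * (y + (- a / 2) * s)\<^sup>2 + b\<^sup>2 * (z + (- b / 2) * s)\<^sup>2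
      + 2 * ((y + (- a / 2) * s) * (z + (- b / 2) * s)) + 2 * b * ((z + (- b / 2) * s) * (x + 1 * s))
      + 2 * a * ((x + 1 * s) * (y + (- a / 2) * s))
    = 0 \<longleftrightarrow> 0 * x\<^sup>2 + 0 * y\<^sup>2 + 0 * z\<^sup>2 + 2 * (y * z) + 1 * (z * x) + 1 * (x * y) = 0"
proof -
  have a': "a * (a * r) = r + 2 * a * r" for r
    using a by (simp flip: mult.assoc) (simp add: algebra_simps)
  \<comment> \<open>The identity multiplied by 4, free of denominators.\<close>
  have cleared: "4 * (x + 1 * s)\<^sup>2 + a\<^sup>2 * (2 * y - a * s)\<^sup>2 + b\<^sup>2 * (2 * z - b * s)\<^sup>2
      + 2 * (2 * y - a * s) * (2 * z - b * s) + 4 * b * (2 * z - b * s) * (x + 1 * s)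
      + 4 * a * (x + 1 * s) * (2 * y - a * s) + 8 * (2 * (y * z) + z * x + x * y) = 0"
    unfolding b s by (simp add: power2_eq_square algebra_simps a a')
  have double: "4 * (1 * w\<^sup>2 + a\<^sup>2 * (u / 2)\<^sup>2 + b\<^sup>2 * (v / 2)\<^sup>2
      + 2 * (u / 2 * (v / 2)) + 2 * b * (v / 2 * w) + 2 * a * (w * (u / 2)))
      = 4 * w\<^sup>2 + a\<^sup>2 * u\<^sup>2 + b\<^sup>2 * v\<^sup>2 + 2 * u * v + 4 * b * v * w + 4 * a * w * u" for u v w
    by (simp add: power2_eq_square algebra_simps)
  have halves: "y + (- a / 2) * s = (2 * y - a * s) / 2" "z + (- b / 2) * s = (2 * z - b * s) / 2"
    by (simp_all add: diff_divide_distrib)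
  have "l = 0 \<longleftrightarrow> 0 * x\<^sup>2 + 0 * y\<^sup>2 + 0 * z\<^sup>2 + 2 * (y * z) + 1 * (z * x) + 1 * (x * y) = 0"
    if "4 * l = e" "e + 8 * (2 * (y * z) + z * x + x * y) = 0" for l e
  proof -
    have scaled: "4 * m = - 8 * n \<Longrightarrow> m = 0 \<longleftrightarrow> n = 0" for m n :: real by auto
    have "0 * x\<^sup>2 + 0 * y\<^sup>2 + 0 * z\<^sup>2 + 2 * (y * z) + 1 * (z * x) + 1 * (x * y) = 2 * (y * z) + z * x + x * y"
      by simp
    moreover have "4 * l = - 8 * (2 * (y * z) + z * x + x * y)" using that by linarith
    ultimately show ?thesis using scaled by metis
  qed
  note this[OF double[of "x + 1 * s" "2 * y - a * s" "2 * z - b * s"] cleared]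
  then show ?thesis unfolding halves .
qed

text \<open>
  The preimage of the inconic under \<open>M\<close> is found by substitution; surjectivity turns this into a
  statement about the image.
\<close>

lemma M_image: "ext M ` bary_conic 0 0 0 2 1 1 = inconic A B C P"
proof -
  have "ext (inv M) ` inconic A B C P = bary_conic 0 0 0 2 1 1"
  proof (rule set_eq_by_coordinates)
    fix x y z :: real assume nz: "x \<noteq> 0 \<or> y \<noteq> 0 \<or> z \<noteq> 0"
    show "pnt x y z \<in> ext (inv M) ` inconic A B C P \<longleftrightarrow> pnt x y z \<in> bary_conic 0 0 0 2 1 1"
      unfolding inconic_P image_ext_inv[OF M_map(1,2)] mem_Collect_eq ext_pnt_bij(2)[OF M_map nz]
        pnt_in_bary_conic_iff[OF nz] pnt_in_bary_conic_iff[OF ext_pnt_bij(1)[OF M_map nz]]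
      by (rule translated_conic_identity) (simp_all add: algebra_simps t2)
  qed
  then have "ext M ` bary_conic 0 0 0 2 1 1 = ext M ` ext (inv M) ` inconic A B C P" by (rule arg_cong[OF sym])
  also have "\<dots> = inconic A B C P" unfolding image_image ext_ext_inv[OF M_map(1,2)] by (rule image_ident)
  finally show ?thesis .
qed

lemma complement_P': "ext (complement A B C) P' = pnt 2 (- t) t"
  using t_nonzero by (subst ext_complement) auto

text \<open>
  The point on the right was found by solving the linear system \<open>T X = K(K(P))\<close>; it remains to apply
  \<open>T\<close> to it.
\<close>

lemma generalized_circumcenter_P':
  "ext (inv T) (ext (complement A B C) (ext (complement A B C) P)) = pnt (- 4) (5 + 4 * t) (5 - 4 * t)"
proof -
  have K1: "ext (complement A B C) P = pnt 2 (2 + t) (2 - t)"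
    by (subst ext_complement) simp_all
  have K2: "ext (complement A B C) (pnt 2 (2 + t) (2 - t)) = pnt 4 (4 - t) (4 + t)"
    by (subst ext_complement) simp_all
  have coords: "(5 + 4 * t) * (2 - t) + (5 - 4 * t) * (2 + t) = 4"
    "(1 - t) * (- 4 + (5 - 4 * t) * (2 + t)) = 4 - t"
    "(1 + t) * (- 4 + (5 + 4 * t) * (2 - t)) = 4 + t"
    by (simp_all add: algebra_simps t2 t2')
  have "lift T (hvec (- 4) (5 + 4 * t) (5 - 4 * t)) = hvec (4 / 2) ((4 - t) / 2) ((4 + t) / 2)"
    unfolding T_map(3) coords ..
  from ext_pnt_bij(2)[OF T_map(1,2) this]
  have "ext T (pnt (- 4) (5 + 4 * t) (5 - 4 * t)) = pnt (4 / 2) ((4 - t) / 2) ((4 + t) / 2)"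
    by simp
  also have "\<dots> = pnt (1 / 2 * 4) (1 / 2 * (4 - t)) (1 / 2 * (4 + t))" by simp
  also have "\<dots> = pnt 4 (4 - t) (4 + t)" by (rule pnt_scale) simp
  finally have "pnt 4 (4 - t) (4 + t) = ext T (pnt (- 4) (5 + 4 * t) (5 - 4 * t))" ..
  then show ?thesis unfolding K1 K2 by (simp only: ext_inv_ext[OF T_map(1,2)])
qed

text \<open>
  The common line is \<open>2t x + y - z = 0\<close>.
\<close>

lemma line_through_centers_and_P:
  "ecollinear {pnt 0 1 1, pnt (- 4) (5 + 4 * t) (5 - 4 * t), P, P'}"
  unfolding ecollinear_def
  by (intro exI[of _ "lin (2 * t) 1 (- 1)"] conjI is_line_lin) (auto simp: pnt_in_lin_iff)

lemma P_affine: "P = ord_pt (apt (1 / 3) ((1 - t) / 3) ((1 + t) / 3))"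
  "P' = ord_pt (apt (- 1) (1 + t) (1 - t))"
proof -
  have "P = pnt (1/3 * 1) (1/3 * (1 - t)) (1/3 * (1 + t))" by (rule pnt_scale[symmetric]) simp
  moreover have "1 / 3 + (1 - t) / 3 + (1 + t) / 3 = 1" by (simp add: field_simps)
  ultimately show "P = ord_pt (apt (1 / 3) ((1 - t) / 3) ((1 + t) / 3))" by (simp add: ord_pt_apt)
qed (simp add: ord_pt_apt)

lemma midpoint_BC: "midpoint B C = apt 0 (1 / 2) (1 / 2)" "ord_pt (midpoint B C) = pnt 0 1 1"
proof -
  show *: "midpoint B C = apt 0 (1 / 2) (1 / 2)" by (simp add: midpoint_def apt_def scaleR_add_right)
  have "ord_pt (midpoint B C) = pnt (1/2 * 0) (1/2 * 1) (1/2 * 1)" by (simp add: * ord_pt_apt)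
  also have "\<dots> = pnt 0 1 1" by (rule pnt_scale) simp
  finally show "ord_pt (midpoint B C) = pnt 0 1 1" .
qed

lemma apt_diff: "apt x y z - apt x' y' z' = apt (x - x') (y - y') (z - z')"
  by (simp add: apt_def scaleR_left_diff_distrib)

lemma apt_scale: "k *\<^sub>R apt x y z = apt (k * x) (k * y) (k * z)"
  by (simp add: apt_def scaleR_add_right)

lemma dist_ratio:
  "dist (midpoint B C) (apt (- 1) (1 + t) (1 - t))
    = 3 * dist (midpoint B C) (apt (1 / 3) ((1 - t) / 3) ((1 + t) / 3))"
proof -
  have "apt (- 1) (1 + t) (1 - t) - midpoint B C
    = (- 3) *\<^sub>R (apt (1 / 3) ((1 - t) / 3) ((1 + t) / 3) - midpoint B C)"
    unfolding midpoint_BC(1) apt_diff apt_scale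
    by (simp add: add_divide_distrib diff_divide_distrib algebra_simps)
  then have "norm (apt (- 1) (1 + t) (1 - t) - midpoint B C)
    = 3 * norm (apt (1 / 3) ((1 - t) / 3) ((1 + t) / 3) - midpoint B C)"
    by (simp only: norm_scaleR)
  then show ?thesis by (simp only: dist_norm norm_minus_commute)
qed

lemma centroid_pnt: "ord_pt (centroid A B C) = pnt 1 1 1"
proof -
  have "centroid A B C = apt (1/3 * 1) (1/3 * 1) (1/3 * 1)"
    by (simp add: centroid_def apt_def scaleR_add_right)
  then have "ord_pt (centroid A B C) = pnt (1/3 * 1) (1/3 * 1) (1/3 * 1)" by (simp add: ord_pt_apt)
  also have "\<dots> = pnt 1 1 1" by (rule pnt_scale) simp
  finally show ?thesis .
qed

text \<open>
  Eliminating \<open>z = 2x - y\<close> from the equation of the circumconic leaves \<open>(y - x)\<^sup>2 = 2x\<^sup>2 = (tx)\<^sup>2\<close>.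
\<close>

lemma intersection_eq: "lin (- 2) 1 1 \<inter> bary_conic 0 0 0 2 1 1 = {P, pnt 1 (1 + t) (1 - t)}"
proof (rule set_eq_by_coordinates)
  fix x y z :: real assume nz: "x \<noteq> 0 \<or> y \<noteq> 0 \<or> z \<noteq> 0"
  have "y + z = 2 * x \<and> 2 * (y * z) + z * x + x * y = 0
    \<longleftrightarrow> (y = (1 - t) * x \<and> z = (1 + t) * x) \<or> (y = (1 + t) * x \<and> z = (1 - t) * x)"
  proof
    assume a: "y + z = 2 * x \<and> 2 * (y * z) + z * x + x * y = 0"
    then have "(y - (1 - t) * x) * (y - (1 + t) * x) = 0" using t2 by algebra
    then have "y = (1 - t) * x \<or> y = (1 + t) * x" by simp
    then show "(y = (1 - t) * x \<and> z = (1 + t) * x) \<or> (y = (1 + t) * x \<and> z = (1 - t) * x)"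
      using a by (auto simp: ring_distribs)
  next
    assume "(y = (1 - t) * x \<and> z = (1 + t) * x) \<or> (y = (1 + t) * x \<and> z = (1 - t) * x)"
    then show "y + z = 2 * x \<and> 2 * (y * z) + z * x + x * y = 0"
      by (elim disjE conjE; simp only:; simp add: algebra_simps t2 t2')
  qed
  moreover have "pnt x y z = P \<longleftrightarrow> y = (1 - t) * x \<and> z = (1 + t) * x"
    using nz by (subst pnt_eq_iff) (auto simp: mult_ac)
  moreover have "pnt x y z = pnt 1 (1 + t) (1 - t) \<longleftrightarrow> y = (1 + t) * x \<and> z = (1 - t) * x"
    using nz by (subst pnt_eq_iff) (auto simp: mult_ac)
  ultimately show "pnt x y z \<in> lin (- 2) 1 1 \<inter> bary_conic 0 0 0 2 1 1 \<longleftrightarrow> pnt x y z \<in> {P, pnt 1 (1 + t) (1 - t)}"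
    using nz by (simp add: pnt_in_lin_iff pnt_in_bary_conic_iff algebra_simps)
qed

lemma intersection_two_points: "P \<noteq> pnt 1 (1 + t) (1 - t)"
  using t_nonzero by (simp add: pnt_eq_iff)

end


section \<open>The proposition\<close>

theorem proposition2p4:
  fixes A B C :: "real^2" and P H :: epoint
  defines "G \<equiv> ord_pt (centroid A B C)"
    and "K \<equiv> ext (complement A B C)"
    and "Kinv \<equiv> ext (inv (complement A B C))"
    and "BC \<equiv> join (ord_pt B) (ord_pt C)"
    and "P' \<equiv> isotomic A B C P"
  defines "Q \<equiv> K P'"
    and "Q' \<equiv> K P"
    and "T\<^sub>P \<equiv> cevian_map A B C P"
    and "T\<^sub>P' \<equiv> cevian_map A B C P'"
  defines "O\<^sub>1 \<equiv> K H"
    and "O\<^sub>2 \<equiv> ext (inv T\<^sub>P) (K Q')"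
    and "M \<equiv> T\<^sub>P \<circ> inv (complement A B C) \<circ> T\<^sub>P'"
    and "\<C> \<equiv> ext (inv T\<^sub>P') ` nine_point_conic (ord_pt A) (ord_pt B) (ord_pt C) P'"
    and "\<I> \<equiv> inconic A B C P"
    and "l \<equiv> Kinv ` join (ord_pt A) Q"
    and "l\<^sub>G \<equiv> parallel_through G BC"
  assumes "\<not> collinear {A, B, C}"
    and "\<not> on_sides A B C P"
    and "\<not> on_sides (inv (complement A B C) A) (inv (complement A B C) B)
            (inv (complement A B C) C) P"
    and "generalized_orthocenter A B C P H"
    and "H = ord_pt A"
    and "O\<^sub>1 = ord_pt (midpoint B C)"
    and "trace_on A B C P' = emidpoint (ord_pt A) P'"
  shows "\<C> = isotomic_line A B C l
    \<and> l = Kinv ` Kinv ` BC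
    \<and> (\<exists>A\<^sub>1. emidpoint (ord_pt A) A\<^sub>1 = O\<^sub>1 \<and> l = parallel_through A\<^sub>1 BC)
    \<and> ecollinear {O\<^sub>1, O\<^sub>2, P, P'}
    \<and> (\<exists>o\<^sub>1 p p'. O\<^sub>1 = ord_pt o\<^sub>1 \<and> P = ord_pt p \<and> P' = ord_pt p' \<and>
          dist o\<^sub>1 p' = 3 * dist o\<^sub>1 p)
    \<and> is_translation M \<and> ext M ` \<C> = \<I>
    \<and> P \<in> l\<^sub>G \<inter> \<C> \<and> card (l\<^sub>G \<inter> \<C>) = 2"
proof -
  interpret triangle A B C by unfold_locales fact
  have orthocenter: "generalized_orthocenter A B C P (ord_pt A)"
    using \<open>generalized_orthocenter A B C P H\<close> \<open>H = ord_pt A\<close> by simp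
  have trace: "trace_on A B C (isotomic A B C P) = emidpoint (ord_pt A) (isotomic A B C P)"
    using \<open>trace_on A B C P' = emidpoint (ord_pt A) P'\<close> unfolding P'_def .
  obtain t where t: "t * t = 2" and P: "P = pnt 1 (1 - t) (1 + t)"
    by (rule point_determined[OF \<open>\<not> on_sides A B C P\<close>
          \<open>\<not> on_sides (inv (complement A B C) A) (inv (complement A B C) B)
              (inv (complement A B C) C) P\<close> orthocenter trace]) (rule that)
  interpret special_triangle A B C t by unfold_locales fact
  have P': "P' = pnt (- 1) (1 + t) (1 - t)" unfolding P'_def P by (rule isotomic_P)
  have Q: "Q = pnt 2 (- t) t" unfolding Q_def K_def P' by (rule complement_P')
  have l: "l = lin 2 1 1"
  proof -
    have "join (ord_pt A) Q = lin 0 1 1"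
      using t_nonzero unfolding Q by (simp add: join_vertex lin_eq_iff)
    then show ?thesis by (simp add: l_def Kinv_def image_anticomplement_lin)
  qed
  have C: "\<C> = bary_conic 0 0 0 2 1 1"
    unfolding \<C>_def T\<^sub>P'_def P' by (rule circumconic_eq)
  have M: "M = cevian_map A B C (pnt 1 (1 - t) (1 + t)) \<circ> inv (complement A B C)
      \<circ> cevian_map A B C (pnt (- 1) (1 + t) (1 - t))"
    unfolding M_def T\<^sub>P_def T\<^sub>P'_def P P' ..
  have O1: "O\<^sub>1 = pnt 0 1 1" using \<open>O\<^sub>1 = ord_pt (midpoint B C)\<close> midpoint_BC(2) by simp
  have O2: "O\<^sub>2 = pnt (- 4) (5 + 4 * t) (5 - 4 * t)"
    unfolding O\<^sub>2_def Q'_def K_def T\<^sub>P_def P by (rule generalized_circumcenter_P')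
  have lG: "l\<^sub>G = lin (- 2) 1 1"
    unfolding l\<^sub>G_def BC_def G_def centroid_pnt by (subst parallel_through_BC) simp_all
  have "\<C> = isotomic_line A B C l" unfolding C l by (rule isotomic_line_lin[symmetric]) simp
  moreover have "l = Kinv ` Kinv ` BC"
    unfolding l BC_def Kinv_def sides image_anticomplement_lin by simp
  moreover have "\<exists>A\<^sub>1. emidpoint (ord_pt A) A\<^sub>1 = O\<^sub>1 \<and> l = parallel_through A\<^sub>1 BC"
  proof (intro exI conjI)
    show "emidpoint (ord_pt A) (pnt (- 1) 1 1) = O\<^sub>1"
      unfolding O1 ord_pt_vertices by (subst emidpoint_pnt) simp_all
    have "lin (- 2) (- 1) (- 1) = lin 2 1 1" by (subst lin_eq_iff) simp_all
    then show "l = parallel_through (pnt (- 1) 1 1) BC"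
      unfolding l BC_def by (subst parallel_through_BC) simp_all
  qed
  moreover have "ecollinear {O\<^sub>1, O\<^sub>2, P, P'}"
    unfolding O1 O2 P P' by (rule line_through_centers_and_P)
  moreover have "\<exists>o\<^sub>1 p p'. O\<^sub>1 = ord_pt o\<^sub>1 \<and> P = ord_pt p \<and> P' = ord_pt p' \<and>
      dist o\<^sub>1 p' = 3 * dist o\<^sub>1 p"
    using \<open>O\<^sub>1 = ord_pt (midpoint B C)\<close> P_affine dist_ratio unfolding P P' by blast
  moreover have "is_translation M" unfolding M by (rule M_translation)
  moreover have "ext M ` \<C> = \<I>" unfolding M C \<I>_def P by (rule M_image)
  moreover have "l\<^sub>G \<inter> \<C> = {P, pnt 1 (1 + t) (1 - t)}" unfolding lG C P by (rule intersection_eq)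
  then have "P \<in> l\<^sub>G \<inter> \<C>" "card (l\<^sub>G \<inter> \<C>) = 2"
    using intersection_two_points unfolding P by simp_all
  ultimately show ?thesis by blast
qed

end
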